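(* Let $n\ge 2$ and $m\ge 0$, let $A:\mathbb{R}^n\to\mathbb{R}^n$ be a magnetic potential, and assume that the magnetic Dirac operator $\mathcal{H}=i^{-1}\alpha\cdot\nabla_A+m\beta$, $\nabla_A=\nabla-iA$, satisfies the self-adjointness assumption (A) described in the context. Let $\phi:\mathbb{R}^n\to\mathbb{R}$ be a real valued function. Then any solution $u:\mathbb{R}_t\times\mathbb{R}^n_x\to\mathbb{C}^M$ of $$iu_t+\mathcal{H}u=0$$ satisfies the following virial identity (formally, in the sense explained in the context): $$ \begin{aligned} &2\int_{\mathbb{R}^n}\sum_{j,k=1}^n \partial_j\partial_k\phi\,\langle \nabla_{A,j}u,\nabla_{A,k}u\rangle\,dx-\frac12\int_{\mathbb{R}^n}|u|^2\Delta^2\phi\,dx +2\int_{\mathbb{R}^n}\sum_{j,k=1}^n \partial_j\phi\,B^{jk}\,\Im\langle u,\nabla_{A,k}u\rangle\,dx\\ &\quad+i\int_{\mathbb{R}^n}\sum_{1\le j<k\le n}(\nabla\phi\cdot\nabla B^{jk})\,\langle\alpha_j\alpha_k u,u\rangle\,dx =-\frac{d}{dt}\int_{\mathbb{R}^n}\Re\Big(2\sum_{k=1}^n\partial_k\phi\,\langle u_t,\nabla_{A,k}u\rangle+\Delta\phi\,\langle u_t,u\rangle\Big)dx . \end{aligned} $$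
   Context: $\alpha_0=\beta,\alpha_1,\dots,\alpha_n$ are $M\times M$ hermitian matrices with $\alpha_j\alpha_k+\alpha_k\alpha_j=2\delta_{jk}\mathbb{I}_M$ for $0\le j,k\le n$. $\nabla_A=\nabla-iA$ has components $\nabla_{A,k}=\partial_k-iA^k$, and $i^{-1}\alpha\cdot\nabla_A=i^{-1}\sum_{k=1}^n\alpha_k(\partial_k-iA^k)$. For $a,b\in\mathbb{C}^M$, $\langle a,b\rangle=\sum_{l=1}^M a_l\overline{b_l}$. The constant $m\ge0$ is the mass. The magnetic field is the skew-symmetric matrix valued function $B=DA-DA^t$ with entries $B^{jk}=\partial_{x_k}A^j-\partial_{x_j}A^k$. Self-adjointness assumption (A): $\mathcal{H}$ is essentially selfadjoint on $C_c^\infty(\mathbb{R}^n)$ ($\mathbb{C}^M$-valued functions), and for initial data $f\in C_c^\infty(\mathbb{R}^n)$ the flow $e^{it\mathcal{H}}f$ (the solution of $iu_t+\mathcal{H}u=0$, $u(0,\cdot)=f$) belongs at least to $C(\mathbb{R},H^{3/2})$. "Formal" identity means: the identity is asserted whenever $A$, $\phi$, $u$ are regular enough, and $u$ decays enough at infinity, that all the expressions make sense, the integrals converge, and differentiation in $t$ under the integral sign and integrations by parts in $x$ without boundary terms are legitimate. *)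

theory Defs
  imports "HOL-Analysis.Analysis"
begin

section \<open>Derivatives and smoothness\<close>

definition dird :: "'a::real_normed_vector \<Rightarrow> ('a \<Rightarrow> 'b::real_normed_vector) \<Rightarrow> 'a \<Rightarrow> 'b"
  where "dird b f x = vector_derivative (\<lambda>s. f (x + s *\<^sub>R b)) (at 0)"

definition pd :: "'n::finite \<Rightarrow> (real^'n \<Rightarrow> 'b::real_normed_vector) \<Rightarrow> real^'n \<Rightarrow> 'b"
  where "pd k f = dird (axis k 1) f"

definition lap :: "(real^'n::finite \<Rightarrow> 'b::real_normed_vector) \<Rightarrow> real^'n \<Rightarrow> 'b"
  where "lap f x = (\<Sum>k\<in>UNIV. pd k (pd k f) x)"

definition dt :: "(real \<Rightarrow> 'a \<Rightarrow> 'b::real_normed_vector) \<Rightarrow> real \<Rightarrow> 'a \<Rightarrow> 'b"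
  where "dt u t x = vector_derivative (\<lambda>s. u s x) (at t)"

primrec Ck :: "nat \<Rightarrow> ('a::euclidean_space \<Rightarrow> 'b::real_normed_vector) \<Rightarrow> bool" where
  "Ck 0 f \<longleftrightarrow> continuous_on UNIV f"
| "Ck (Suc k) f \<longleftrightarrow> (\<forall>x. f differentiable (at x)) \<and> (\<forall>b\<in>Basis. Ck k (dird b f))"

definition test_functions :: "(real^'n::finite \<Rightarrow> complex^'m::finite) set"
  where "test_functions = {f. (\<forall>k. Ck k f) \<and> compact (closure {x. f x \<noteq> 0})}"


section \<open>The magnetic Dirac operator\<close>

text \<open>Linear in the first argument.\<close>

definition cinner :: "complex^'m::finite \<Rightarrow> complex^'m \<Rightarrow> complex"
  where "cinner a b = (\<Sum>l\<in>UNIV. a $ l * cnj (b $ l))"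

definition hermitian :: "complex^'m::finite^'m \<Rightarrow> bool"
  where "hermitian X \<longleftrightarrow> (\<forall>i j. X $ i $ j = cnj (X $ j $ i))"

text \<open>\<open>\<beta>\<close> plays the role of \<open>\<alpha>\<close> with index \<open>0\<close>; \<open>mat 2\<close> is twice the identity matrix.\<close>

definition dirac_matrices :: "complex^'m::finite^'m \<Rightarrow> ('n \<Rightarrow> complex^'m^'m) \<Rightarrow> bool"
  where "dirac_matrices \<beta> \<alpha> \<longleftrightarrow>
    hermitian \<beta> \<and> (\<forall>j. hermitian (\<alpha> j)) \<and>
    \<beta> ** \<beta> + \<beta> ** \<beta> = mat 2 \<and>
    (\<forall>j. \<alpha> j ** \<beta> + \<beta> ** \<alpha> j = 0) \<and>
    (\<forall>j k. \<alpha> j ** \<alpha> k + \<alpha> k ** \<alpha> j = (if j = k then mat 2 else 0))"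

definition covd ::
  "(real^'n::finite \<Rightarrow> real^'n) \<Rightarrow> 'n \<Rightarrow> (real^'n \<Rightarrow> complex^'m::finite) \<Rightarrow> real^'n \<Rightarrow> complex^'m"
  where "covd A k f x = pd k f x - (\<i> * complex_of_real (A x $ k)) *s f x"

definition magB :: "(real^'n::finite \<Rightarrow> real^'n) \<Rightarrow> 'n \<Rightarrow> 'n \<Rightarrow> real^'n \<Rightarrow> real"
  where "magB A j k x = pd k (\<lambda>y. A y $ j) x - pd j (\<lambda>y. A y $ k) x"

definition dirac_op ::
  "(real^'n::finite \<Rightarrow> real^'n) \<Rightarrow> real \<Rightarrow> complex^'m::finite^'m \<Rightarrow> ('n \<Rightarrow> complex^'m^'m) \<Rightarrow>
   (real^'n \<Rightarrow> complex^'m) \<Rightarrow> real^'n \<Rightarrow> complex^'m"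
  where "dirac_op A m \<beta> \<alpha> f x =
    inverse \<i> *s (\<Sum>k\<in>UNIV. \<alpha> k *v covd A k f x) + complex_of_real m *s (\<beta> *v f x)"


section \<open>Essential self-adjointness on \<open>L\<^sup>2\<close>\<close>

text \<open>
  Elements of \<open>L\<^sup>2\<close> are represented by functions, and an operator by its graph, a set of pairs of
  functions. Adjoints and closures are closed under almost-everywhere equality in both components,
  so comparing them as sets amounts to comparing the operators on equivalence classes.
\<close>

definition L2 :: "(real^'n::finite \<Rightarrow> complex^'m::finite) set"
  where "L2 = {f. f \<in> borel_measurable lborel \<and> integrable lborel (\<lambda>x. (norm (f x))\<^sup>2)}"

definition L2_inner ::
  "(real^'n::finite \<Rightarrow> complex^'m::finite) \<Rightarrow> (real^'n \<Rightarrow> complex^'m) \<Rightarrow> complex"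
  where "L2_inner f g = (\<integral>x. cinner (f x) (g x) \<partial>lborel)"

definition L2_dist ::
  "(real^'n::finite \<Rightarrow> complex^'m::finite) \<Rightarrow> (real^'n \<Rightarrow> complex^'m) \<Rightarrow> real"
  where "L2_dist f g = sqrt (\<integral>x. (norm (f x - g x))\<^sup>2 \<partial>lborel)"

type_synonym ('n, 'm) op_graph =
  "((real^'n \<Rightarrow> complex^'m) \<times> (real^'n \<Rightarrow> complex^'m)) set"

definition adjoint_graph :: "('n::finite, 'm::finite) op_graph \<Rightarrow> ('n, 'm) op_graph"
  where "adjoint_graph G =
    {(v, w). v \<in> L2 \<and> w \<in> L2 \<and> (\<forall>(f, g)\<in>G. L2_inner g v = L2_inner f w)}"

definition closure_graph :: "('n::finite, 'm::finite) op_graph \<Rightarrow> ('n, 'm) op_graph"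
  where "closure_graph G =
    {(f, g). f \<in> L2 \<and> g \<in> L2 \<and>
      (\<exists>F K. (\<forall>i::nat. (F i, K i) \<in> G) \<and>
        (\<lambda>i. L2_dist (F i) f) \<longlonglongrightarrow> 0 \<and> (\<lambda>i. L2_dist (K i) g) \<longlonglongrightarrow> 0)}"

definition essentially_selfadjoint :: "('n::finite, 'm::finite) op_graph \<Rightarrow> bool"
  where "essentially_selfadjoint G \<longleftrightarrow> G \<subseteq> L2 \<times> L2 \<and>
    adjoint_graph (closure_graph G) = closure_graph G"

definition dirac_graph ::
  "(real^'n::finite \<Rightarrow> real^'n) \<Rightarrow> real \<Rightarrow> complex^'m::finite^'m \<Rightarrow> ('n \<Rightarrow> complex^'m^'m) \<Rightarrow>
   ('n, 'm) op_graph"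
  where "dirac_graph A m \<beta> \<alpha> = (\<lambda>f. (f, dirac_op A m \<beta> \<alpha> f)) ` test_functions"

text \<open>
  For self-adjoint \<open>G\<close>, the map \<open>t \<mapsto> e\<^sup>i\<^sup>t\<^sup>G f\<close> with \<open>f\<close> in the domain of \<open>G\<close> is the unique (up to
  almost-everywhere equality) \<open>L\<^sup>2\<close>-differentiable \<open>U\<close> with values in the domain of \<open>G\<close> such that
  \<open>U' = i G U\<close> and \<open>U(0) = f\<close>.
\<close>

definition unitary_flow ::
  "('n::finite, 'm::finite) op_graph \<Rightarrow> (real^'n \<Rightarrow> complex^'m) \<Rightarrow>
   (real \<Rightarrow> real^'n \<Rightarrow> complex^'m) \<Rightarrow> bool"
  where "unitary_flow G f U \<longleftrightarrow> (AE x in lborel. U 0 x = f x) \<and>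
    (\<exists>V. \<forall>t. (U t, V t) \<in> G \<and>
      ((\<lambda>h. L2_dist (\<lambda>x. (1 / h) *\<^sub>R (U (t + h) x - U t x)) (\<lambda>x. \<i> *s V t x)) \<longlongrightarrow> 0) (at 0))"


section \<open>Sobolev spaces\<close>

definition fourier_integral ::
  "(real^'n::finite \<Rightarrow> complex^'m::finite) \<Rightarrow> real^'n \<Rightarrow> complex^'m"
  where "fourier_integral f \<xi> =
    (2 * pi) powr (- real CARD('n) / 2) *\<^sub>R (\<integral>x. cis (- (x \<bullet> \<xi>)) *s f x \<partial>lborel)"

text \<open>The Fourier transform on \<open>L\<^sup>2\<close>, as the closure of the one on test functions.\<close>

definition has_fourier_transform ::
  "(real^'n::finite \<Rightarrow> complex^'m::finite) \<Rightarrow> (real^'n \<Rightarrow> complex^'m) \<Rightarrow> bool"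
  where "has_fourier_transform f g \<longleftrightarrow>
    (f, g) \<in> closure_graph ((\<lambda>h. (h, fourier_integral h)) ` test_functions)"

text \<open>\<open>U\<close> is a continuous curve in the Sobolev space \<open>H\<^sup>s\<close>; \<open>W t\<close> is the transform of \<open>U t\<close>.\<close>

definition continuous_into_Hs :: "real \<Rightarrow> (real \<Rightarrow> real^'n::finite \<Rightarrow> complex^'m::finite) \<Rightarrow> bool"
  where "continuous_into_Hs s U \<longleftrightarrow>
    (\<exists>W. (\<forall>t. has_fourier_transform (U t) (W t) \<and>
          integrable lborel (\<lambda>\<xi>. (1 + (norm \<xi>)\<^sup>2) powr s * (norm (W t \<xi>))\<^sup>2)) \<and>
      (\<forall>t\<^sub>0. ((\<lambda>t. \<integral>\<xi>. (1 + (norm \<xi>)\<^sup>2) powr s * (norm (W t \<xi> - W t\<^sub>0 \<xi>))\<^sup>2 \<partial>lborel)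
              \<longlongrightarrow> 0) (at t\<^sub>0)))"

definition selfadjointness_assumption ::
  "(real^'n::finite \<Rightarrow> real^'n) \<Rightarrow> real \<Rightarrow> complex^'m::finite^'m \<Rightarrow> ('n \<Rightarrow> complex^'m^'m) \<Rightarrow> bool"
  where "selfadjointness_assumption A m \<beta> \<alpha> \<longleftrightarrow>
    essentially_selfadjoint (dirac_graph A m \<beta> \<alpha>) \<and>
    (\<forall>f\<in>test_functions. \<exists>U. unitary_flow (closure_graph (dirac_graph A m \<beta> \<alpha>)) f U \<and>
      continuous_into_Hs (3/2) U)"


section \<open>Regularity and decay making the virial identity meaningful\<close>

text \<open>The density whose time derivative appears in the identity.\<close>

definition virial_density ::
  "(real^'n::finite \<Rightarrow> real^'n) \<Rightarrow> (real^'n \<Rightarrow> real) \<Rightarrow>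
   (real \<Rightarrow> real^'n \<Rightarrow> complex^'m::finite) \<Rightarrow> real \<Rightarrow> real^'n \<Rightarrow> real"
  where "virial_density A \<phi> u t x =
    Re (2 * (\<Sum>k\<in>UNIV. complex_of_real (pd k \<phi> x) * cinner (dt u t x) (covd A k (u t) x))
        + complex_of_real (lap \<phi> x) * cinner (dt u t x) (u t x))"

definition regular_enough ::
  "(real^'n::finite \<Rightarrow> real^'n) \<Rightarrow> (real^'n \<Rightarrow> real) \<Rightarrow>
   (real \<Rightarrow> real^'n \<Rightarrow> complex^'m::finite) \<Rightarrow> bool"
  where "regular_enough A \<phi> u \<longleftrightarrow> Ck 2 A \<and> Ck 4 \<phi> \<and> Ck 2 (\<lambda>(t, x). u t x)"

definition integrals_converge ::
  "(real^'n::{finite,linorder} \<Rightarrow> real^'n::{finite,linorder}) \<Rightarrow>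
   (real^'n::{finite,linorder} \<Rightarrow> real) \<Rightarrow> ('n \<Rightarrow> complex^'m::finite^'m) \<Rightarrow>
   (real \<Rightarrow> real^'n::{finite,linorder} \<Rightarrow> complex^'m) \<Rightarrow> bool"
  where "integrals_converge A \<phi> \<alpha> u \<longleftrightarrow> (\<forall>t.
    integrable lborel (\<lambda>x. \<Sum>j\<in>UNIV. \<Sum>k\<in>UNIV. complex_of_real (pd j (pd k \<phi>) x) *
      cinner (covd A j (u t) x) (covd A k (u t) x)) \<and>
    integrable lborel (\<lambda>x. (norm (u t x))\<^sup>2 * lap (lap \<phi>) x) \<and>
    integrable lborel (\<lambda>x. \<Sum>j\<in>UNIV. \<Sum>k\<in>UNIV. pd j \<phi> x * magB A j k x *
      Im (cinner (u t x) (covd A k (u t) x))) \<and>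
    integrable lborel (\<lambda>x. \<Sum>(j, k)\<in>{(j, k). j < k}.
      complex_of_real (\<Sum>l\<in>UNIV. pd l \<phi> x * pd l (magB A j k) x) *
      cinner ((\<alpha> j ** \<alpha> k) *v u t x) (u t x)) \<and>
    integrable lborel (virial_density A \<phi> u t))"

text \<open>Differentiation in \<open>t\<close> under the integral sign is by (locally uniform) domination.\<close>

definition time_derivative_dominated ::
  "(real^'n::finite \<Rightarrow> real^'n) \<Rightarrow> (real^'n \<Rightarrow> real) \<Rightarrow>
   (real \<Rightarrow> real^'n \<Rightarrow> complex^'m::finite) \<Rightarrow> bool"
  where "time_derivative_dominated A \<phi> u \<longleftrightarrow> (\<forall>t\<^sub>0. \<exists>\<epsilon>>0. \<exists>g. integrable lborel g \<and>
    (\<forall>t x. \<bar>t - t\<^sub>0\<bar> < \<epsilon> \<longrightarrow> \<bar>dt (virial_density A \<phi> u) t x\<bar> \<le> g x))"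

text \<open>
  For a \<open>C\<^sup>1\<close> function \<open>F\<close> such that \<open>F\<close> and its partial derivatives are integrable, the partial
  derivatives of \<open>F\<close> have integral \<open>0\<close>. So integrability is all that is needed for integrations
  by parts without boundary terms; the condition below requires it for the products of derivatives
  of \<open>\<phi>\<close> with the quadratic expressions in \<open>u\<close> that are moved around by them.
\<close>

definition integrable_C1 :: "(real^'n::finite \<Rightarrow> complex) \<Rightarrow> bool"
  where "integrable_C1 F \<longleftrightarrow> integrable lborel F \<and> (\<forall>i. integrable lborel (pd i F))"

definition no_boundary_terms ::
  "(real^'n::finite \<Rightarrow> real^'n) \<Rightarrow> real \<Rightarrow> (real^'n \<Rightarrow> real) \<Rightarrow>
   ('n \<Rightarrow> complex^'m::finite^'m) \<Rightarrow> (real \<Rightarrow> real^'n \<Rightarrow> complex^'m) \<Rightarrow> bool"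
  where "no_boundary_terms A m \<phi> \<alpha> u \<longleftrightarrow> (\<forall>t j k l.
    integrable_C1 (\<lambda>x. complex_of_real (pd l \<phi> x) *
      cinner (covd A j (u t) x) (covd A k (u t) x)) \<and>
    integrable_C1 (\<lambda>x. complex_of_real (lap \<phi> x) * cinner (covd A j (u t) x) (u t x)) \<and>
    integrable_C1 (\<lambda>x. complex_of_real (pd l (lap \<phi>) x * (norm (u t x))\<^sup>2)) \<and>
    integrable_C1 (\<lambda>x. complex_of_real (pd l \<phi> x * (norm (dt u t x))\<^sup>2)) \<and>
    integrable_C1 (\<lambda>x. complex_of_real (m\<^sup>2 * pd l \<phi> x * (norm (u t x))\<^sup>2)) \<and>
    integrable_C1 (\<lambda>x. complex_of_real (pd l \<phi> x * magB A j k x) *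
      cinner ((\<alpha> j ** \<alpha> k) *v u t x) (u t x)))"

end

theory Submission
  imports Defs
begin

text \<open>
  Squaring the Dirac operator turns the equation into \<open>u\<^sub>t\<^sub>t = - \<H>\<^sup>2 u\<close>, where \<open>- \<H>\<^sup>2\<close> is the magnetic
  Laplacian minus \<open>m\<^sup>2\<close> plus \<open>i \<Sum>\<^bsub>j<k\<^esub> B\<^sup>j\<^sup>k \<alpha>\<^sub>j\<alpha>\<^sub>k\<close>. Substituting this into the time derivative of the
  virial density, the Leibniz rule for \<open>\<nabla>\<^sub>A\<close>, the commutators \<open>[\<nabla>\<^sub>A\<^sub>,\<^sub>j, \<nabla>\<^sub>A\<^sub>,\<^sub>k] = i B\<^sup>j\<^sup>k\<close> and the
  hermiticity of \<open>i \<alpha>\<^sub>j\<alpha>\<^sub>k\<close> rewrite it pointwise as a divergence minus the integrands on the left of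
  the identity. Divergences of integrable fields with integrable partial derivatives integrate to \<open>0\<close>.
\<close>

section \<open>Directional derivatives\<close>

text \<open>The density pairs u_t with [Delta_A, \<phi>]u = 2 grad \<phi> . nabla_A u + (Delta
  \<phi>) u, where Delta_A is the magnetic Laplacian. If X is a pointwise hermitian multiplier, the
  Leibniz rule gives Re<Xf, [Delta_A, \<phi>]f> = div(<Xf, f> grad \<phi>) - <(grad \<phi> . grad
  X)f, f>. This settles three of the four parts of the time derivative: the kinetic part (X = 1,
  with u_t for f), the mass part (X = m^2) and the magnetic part (X = i/2 times the sum of B^{jk}
  \<alpha>_j \<alpha>_k over all j, k), which is where the gradient of B enters. The part with
  Delta_A u is not of this kind: it takes further integrations by parts, which produce the Hessian,
  the bilaplacian and the term with B^{jk} itself. Every field whose divergence is taken contains at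
  most first derivatives of u, so it is differentiable for u of class C^2.\<close>

lemma dird_eq:
  assumes "(f has_derivative f') (at x)"
  shows "dird b f x = f' b"
proof -
  have "((\<lambda>s. x + s *\<^sub>R b) has_vector_derivative b) (at 0)"
    by (auto intro!: derivative_eq_intros)
  then have "(f \<circ> (\<lambda>s. x + s *\<^sub>R b) has_vector_derivative f' b) (at 0)"
    by (rule vector_derivative_diff_chain_within)
       (use assms in \<open>simp add: has_derivative_at_withinI\<close>)
  then show ?thesis
    unfolding dird_def o_def by (rule vector_derivative_at)
qed

section \<open>Derivatives along lines and symmetry of mixed second derivatives\<close>

lemma has_vector_derivative_along_line:
  assumes "f differentiable (at (x + s *\<^sub>R b))"
  shows "((\<lambda>s. f (x + s *\<^sub>R b)) has_vector_derivative dird b f (x + s *\<^sub>R b)) (at s)"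
proof -
  obtain f' where f': "(f has_derivative f') (at (x + s *\<^sub>R b))"
    using assms unfolding differentiable_def by blast
  have "((\<lambda>s. x + s *\<^sub>R b) has_vector_derivative b) (at s)"
    by (auto intro!: derivative_eq_intros)
  then have "(f \<circ> (\<lambda>s. x + s *\<^sub>R b) has_vector_derivative f' b) (at s)"
    by (rule vector_derivative_diff_chain_within)
       (use f' in \<open>simp add: has_derivative_at_withinI\<close>)
  then show ?thesis
    unfolding o_def dird_eq[OF f'] .
qed

text \<open>The second difference is the increment over h in direction \<open>a\<close> of the
  function f(. + hb) - f, so the mean value theorem applies in direction \<open>a\<close>, and then
  once more to \<open>dird a f\<close> in direction \<open>b\<close>. Exchanging \<open>a\<close>
  and \<open>b\<close> leaves the second difference unchanged but yields the other mixed
  derivative.\<close>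

lemma second_difference_mean_value:
  fixes f :: "'a::real_normed_vector \<Rightarrow> real"
  assumes f: "\<And>x. f differentiable (at x)" and fa: "\<And>x. dird a f differentiable (at x)"
    and "h > 0"
  obtains r s where "0 < r" "r < h" "0 < s" "s < h"
    "f (x + h *\<^sub>R a + h *\<^sub>R b) - f (x + h *\<^sub>R a) - f (x + h *\<^sub>R b) + f x
      = h\<^sup>2 * dird b (dird a f) (x + r *\<^sub>R a + s *\<^sub>R b)"
proof -
  define g where "g r = f ((x + h *\<^sub>R b) + r *\<^sub>R a) - f (x + r *\<^sub>R a)" for r
  have "(g has_real_derivative dird a f ((x + h *\<^sub>R b) + r *\<^sub>R a) - dird a f (x + r *\<^sub>R a)) (at r)" for r
    unfolding g_def has_real_derivative_iff_has_vector_derivative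
    by (intro has_vector_derivative_diff has_vector_derivative_along_line f)
  from MVT2[OF \<open>h > 0\<close> this]
  obtain r where r: "0 < r" "r < h"
    "g h - g 0 = h * (dird a f ((x + h *\<^sub>R b) + r *\<^sub>R a) - dird a f (x + r *\<^sub>R a))"
    by auto
  define k where "k s = dird a f ((x + r *\<^sub>R a) + s *\<^sub>R b)" for s
  have "(k has_real_derivative dird b (dird a f) ((x + r *\<^sub>R a) + s *\<^sub>R b)) (at s)" for s
    unfolding k_def has_real_derivative_iff_has_vector_derivative
    by (intro has_vector_derivative_along_line fa)
  from MVT2[OF \<open>h > 0\<close> this]
  obtain s where s: "0 < s" "s < h" "k h - k 0 = h * dird b (dird a f) ((x + r *\<^sub>R a) + s *\<^sub>R b)"
    by auto
  have "g h - g 0 = h\<^sup>2 * dird b (dird a f) (x + r *\<^sub>R a + s *\<^sub>R b)"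
    using r(3) s(3) unfolding k_def by (simp add: power2_eq_square algebra_simps)
  then show thesis
    using that[of r s] r s unfolding g_def by (simp add: algebra_simps)
qed

text \<open>Both mixed derivatives, at intermediate points within reach of h, equal the same second
  difference divided by h^2. As h tends to 0 the intermediate points tend to \<open>x\<close>, and
  continuity of the mixed derivatives gives equality at \<open>x\<close>.\<close>

lemma dird_commute_real:
  fixes f :: "'a::real_normed_vector \<Rightarrow> real"
  assumes f: "\<And>x. f differentiable (at x)"
    and fa: "\<And>x. dird a f differentiable (at x)" and fb: "\<And>x. dird b f differentiable (at x)"
    and fba: "isCont (dird b (dird a f)) x" and fab: "isCont (dird a (dird b f)) x"
  shows "dird a (dird b f) x = dird b (dird a f) x"
proof -
  define h where "h n = inverse (real (Suc n))" for n
  have h: "h n > 0" for n by (simp add: h_def)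
  have h0: "h \<longlonglongrightarrow> 0" unfolding h_def by (rule LIMSEQ_inverse_real_of_nat)
  have "\<exists>r s r' s'. 0 < r \<and> r < h n \<and> 0 < s \<and> s < h n \<and> 0 < r' \<and> r' < h n \<and> 0 < s' \<and> s' < h n \<and>
     dird b (dird a f) (x + r *\<^sub>R a + s *\<^sub>R b) = dird a (dird b f) (x + r' *\<^sub>R b + s' *\<^sub>R a)" for n
  proof -
    obtain r s where rs: "0 < r" "r < h n" "0 < s" "s < h n"
      "f (x + h n *\<^sub>R a + h n *\<^sub>R b) - f (x + h n *\<^sub>R a) - f (x + h n *\<^sub>R b) + f x
       = (h n)\<^sup>2 * dird b (dird a f) (x + r *\<^sub>R a + s *\<^sub>R b)"
      using second_difference_mean_value[OF f fa h] by metis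
    obtain r' s' where rs': "0 < r'" "r' < h n" "0 < s'" "s' < h n"
      "f (x + h n *\<^sub>R b + h n *\<^sub>R a) - f (x + h n *\<^sub>R b) - f (x + h n *\<^sub>R a) + f x
       = (h n)\<^sup>2 * dird a (dird b f) (x + r' *\<^sub>R b + s' *\<^sub>R a)"
      using second_difference_mean_value[OF f fb h] by metis
    have "(h n)\<^sup>2 * dird b (dird a f) (x + r *\<^sub>R a + s *\<^sub>R b)
        = (h n)\<^sup>2 * dird a (dird b f) (x + r' *\<^sub>R b + s' *\<^sub>R a)"
      using rs(5) rs'(5) add.commute[of "h n *\<^sub>R a" "h n *\<^sub>R b"] by (simp only: add.assoc)
    then show ?thesis using rs rs' h[of n] by auto
  qed
  then obtain r s r' s' where *: "\<And>n. 0 < r n \<and> r n < h n \<and> 0 < s n \<and> s n < h n \<and> 0 < r' n \<and> r' n < h n \<and> 0 < s' n \<and> s' n < h n \<and>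
     dird b (dird a f) (x + r n *\<^sub>R a + s n *\<^sub>R b) = dird a (dird b f) (x + r' n *\<^sub>R b + s' n *\<^sub>R a)"
    by metis
  have lim0: "q \<longlonglongrightarrow> 0" if "\<And>n. 0 < q n \<and> q n < h n" for q
    by (rule tendsto_sandwich[OF _ _ tendsto_const h0])
       (use that in \<open>auto intro!: always_eventually less_imp_le\<close>)
  have pt: "(\<lambda>n. x + q n *\<^sub>R c + q' n *\<^sub>R d) \<longlonglongrightarrow> x"
    if "\<And>n. 0 < q n \<and> q n < h n" "\<And>n. 0 < q' n \<and> q' n < h n" for q q' c d
    using tendsto_add[OF tendsto_add[OF tendsto_const[of x] tendsto_scaleR[OF lim0[OF that(1)] tendsto_const[of c]]]
        tendsto_scaleR[OF lim0[OF that(2)] tendsto_const[of d]]] by simp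
  have "(\<lambda>n. dird b (dird a f) (x + r n *\<^sub>R a + s n *\<^sub>R b)) \<longlonglongrightarrow> dird b (dird a f) x"
    by (rule isCont_tendsto_compose[OF fba pt]) (use * in auto)
  moreover have "(\<lambda>n. dird a (dird b f) (x + r' n *\<^sub>R b + s' n *\<^sub>R a)) \<longlonglongrightarrow> dird a (dird b f) x"
    by (rule isCont_tendsto_compose[OF fab pt]) (use * in auto)
  ultimately show ?thesis
    using * by (simp add: LIMSEQ_unique)
qed

lemma dird_bounded_linear:
  assumes "bounded_linear L" "f differentiable (at x)"
  shows "dird b (\<lambda>x. L (f x)) x = L (dird b f x)"
proof -
  obtain f' where f': "(f has_derivative f') (at x)"
    using assms unfolding differentiable_def by blast
  show ?thesis
    using dird_eq[OF f'] dird_eq[OF bounded_linear.has_derivative[OF assms(1) f']] by simp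
qed

lemma bounded_linear_differentiable:
  "bounded_linear L \<Longrightarrow> f differentiable F \<Longrightarrow> (\<lambda>x. L (f x)) differentiable F"
  unfolding differentiable_def using bounded_linear.has_derivative by blast

lemma Ck_imp_continuous: "Ck k f \<Longrightarrow> continuous_on UNIV f"
  by (cases k) (auto simp: continuous_on_eq_continuous_at differentiable_imp_continuous_within)

text \<open>The mean value theorem is available for real values only, so the claim is tested against
  each basis vector \<open>e\<close>; taking the component along \<open>e\<close> commutes with
  \<open>dird\<close>.\<close>

lemma dird_commute:
  fixes f :: "'a::euclidean_space \<Rightarrow> 'b::euclidean_space"
  assumes "Ck 2 f" "a \<in> Basis" "b \<in> Basis"
  shows "dird a (dird b f) x = dird b (dird a f) x"
proof (rule euclidean_eqI)
  fix e :: 'b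
  have f: "f differentiable (at x)" for x using assms by (simp add: numeral_2_eq_2)
  have df: "dird c f differentiable (at x)" if "c \<in> Basis" for x c
    using assms that by (simp add: numeral_2_eq_2)
  have ddf: "isCont (dird d (dird c f)) x" if "c \<in> Basis" "d \<in> Basis" for x c d
    using assms that by (simp add: numeral_2_eq_2 continuous_on_eq_continuous_at)
  let ?L = "\<lambda>y. y \<bullet> e"
  have L: "bounded_linear ?L" by (rule bounded_linear_inner_left)
  have d1: "dird c (\<lambda>x. ?L (f x)) = (\<lambda>x. ?L (dird c f x))" for c
    using dird_bounded_linear[OF L f] by auto
  have d2: "dird d (\<lambda>x. ?L (dird c f x)) = (\<lambda>x. ?L (dird d (dird c f) x))" if "c \<in> Basis" for c d
    using dird_bounded_linear[OF L df[OF that]] by auto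
  have "dird a (dird b (\<lambda>x. ?L (f x))) x = dird b (dird a (\<lambda>x. ?L (f x))) x"
    by (rule dird_commute_real)
       (use assms(2,3) in \<open>auto simp: d1 d2 intro!: bounded_linear_differentiable[OF L] f df ddf
          continuous_intros\<close>)
  then show "dird a (dird b f) x \<bullet> e = dird b (dird a f) x \<bullet> e"
    by (simp add: d1 d2 assms)
qed

section \<open>Integrals of derivatives and differentiation under the integral\<close>

text \<open>By translation invariance \<open>\<integral>F(x + b) - F(x) dx = 0\<close>; the difference is the integral of the
  derivative over the segment, and Fubini turns the double integral into the one of the derivative.\<close>

lemma integral_dird_eq_0:
  fixes F :: "'a::euclidean_space \<Rightarrow> 'b::euclidean_space"
  assumes dF: "\<And>x. F differentiable (at x)"
    and iF: "integrable lborel F" and idF: "integrable lborel (dird b F)"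
  shows "(\<integral>x. dird b F x \<partial>lborel) = 0"
proof -
  have shift: "integrable lborel (\<lambda>x. G (x + c)) \<and> (\<integral>x. G (x + c) \<partial>lborel) = (\<integral>x. G x \<partial>lborel)"
    if "integrable lborel G" for G :: "'a \<Rightarrow> 'c::{banach,second_countable_topology}" and c
  proof -
    have m[measurable]: "(+) c \<in> borel_measurable borel" by measurable
    have G[measurable]: "G \<in> borel_measurable borel" using that by auto
    have "integrable (distr lborel borel ((+) c)) G"
      by (subst lborel_distr_plus) (rule that)
    then have "integrable lborel (\<lambda>x. G (c + x))"
      by (subst (asm) integrable_distr_eq) auto
    moreover have "(\<integral>x. G x \<partial>distr lborel borel ((+) c)) = (\<integral>x. G (c + x) \<partial>lborel)"
      by (subst integral_distr) auto
    ultimately show ?thesis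
      by (simp add: lborel_distr_plus add.commute)
  qed
  have M[measurable]: "dird b F \<in> borel_measurable borel" using idF by auto
  \<comment> \<open>The cutoff to the segment parameter in [0,1] is put into the integrand, so that
    both variables range over all of \<open>lborel\<close> in Fubini's theorem.\<close>
  define H where "H x s = indicator {0..1::real} s *\<^sub>R dird b F (x + s *\<^sub>R b)" for x s
  have Hmeas: "(\<lambda>(s,x). H x s) \<in> borel_measurable (lborel \<Otimes>\<^sub>M lborel)"
    unfolding H_def by measurable
  have int_norm: "(\<integral>x. norm (dird b F (x + s *\<^sub>R b)) \<partial>lborel) = (\<integral>x. norm (dird b F x) \<partial>lborel)" for s
    using shift[of "\<lambda>x. norm (dird b F x)" "s *\<^sub>R b"] idF by auto
  have Hint: "integrable (lborel \<Otimes>\<^sub>M lborel) (\<lambda>(s,x). H x s)"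
  proof (rule lborel_pair.Fubini_integrable[OF Hmeas])
    have eq: "(\<integral>x. norm (case (s, x) of (s, x) \<Rightarrow> H x s) \<partial>lborel)
        = indicator {0..1} s * (\<integral>x. norm (dird b F x) \<partial>lborel)" for s
      by (simp add: H_def int_norm)
    show "integrable lborel (\<lambda>s. \<integral>x. norm (case (s, x) of (s, x) \<Rightarrow> H x s) \<partial>lborel)"
      unfolding eq by (intro integrable_mult_left) simp
    show "AE s in lborel. integrable lborel (\<lambda>x. case (s, x) of (s, x) \<Rightarrow> H x s)"
      unfolding H_def using shift[OF idF] by auto
  qed
  \<comment> \<open>Fubini gives integrability along the segment for almost every \<open>x\<close>
    only. For such \<open>x\<close> the fundamental theorem for the gauge integral, which asks for
    differentiability but not for a continuous derivative, evaluates the integral, and uniqueness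
    identifies it with the Lebesgue integral.\<close>
  have line: "AE x in lborel. (\<integral>s. H x s \<partial>lborel) = F (x + b) - F x"
  proof -
    have "AE x in lborel. integrable lborel (\<lambda>s. H x s)"
      using lborel_pair.AE_integrable_snd[OF Hint] by simp
    then show ?thesis
    proof (eventually_elim)
      fix x assume "integrable lborel (\<lambda>s. H x s)"
      then have 1: "((\<lambda>s. H x s) has_integral (\<integral>s. H x s \<partial>lborel)) UNIV"
        by (rule has_integral_integral_lborel)
      have "((\<lambda>s. dird b F (x + s *\<^sub>R b)) has_integral F (x + 1 *\<^sub>R b) - F (x + 0 *\<^sub>R b)) {0..1}"
        by (rule fundamental_theorem_of_calculus)
           (auto intro!: has_vector_derivative_at_within has_vector_derivative_along_line dF)
      then have "((\<lambda>s. if s \<in> {0..1} then dird b F (x + s *\<^sub>R b) else 0)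
          has_integral F (x + b) - F x) UNIV"
        unfolding has_integral_restrict_UNIV by simp
      moreover have "(\<lambda>s. if s \<in> {0..1} then dird b F (x + s *\<^sub>R b) else 0) = H x"
        by (auto simp: H_def fun_eq_iff indicator_def)
      ultimately show "(\<integral>s. H x s \<partial>lborel) = F (x + b) - F x"
        using has_integral_unique[OF 1] by simp
    qed
  qed
  have "(\<integral>x. (\<integral>s. H x s \<partial>lborel) \<partial>lborel) = (\<integral>x. F (x + b) - F x \<partial>lborel)"
    using iF shift[OF iF, of b] by (intro integral_cong_AE line lborel.borel_measurable_lebesgue_integral) (use Hmeas in \<open>auto simp: H_def\<close>)
  also have "\<dots> = 0"
    using shift[OF iF, of b] iF by simp
  finally have "(\<integral>s. (\<integral>x. H x s \<partial>lborel) \<partial>lborel) = 0"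
    using lborel_pair.Fubini_integral[OF Hint] by simp
  moreover have "(\<integral>x. H x s \<partial>lborel) = indicator {0..1} s *\<^sub>R (\<integral>x. dird b F x \<partial>lborel)" for s
    using shift[OF idF, of "s *\<^sub>R b"] by (simp add: H_def)
  ultimately show ?thesis by simp
qed

text \<open>By the mean value theorem each difference quotient with step below \<epsilon> is a value
  of the derivative at a time within \<epsilon> of \<open>t\<close>, so \<open>g\<close> dominates
  all of them and dominated convergence applies along any sequence of steps tending to 0.\<close>

lemma has_real_derivative_integral_dominated:
  fixes f f' :: "real \<Rightarrow> 'a \<Rightarrow> real"
  assumes int: "\<And>s. integrable M (f s)"
    and f': "\<And>s x. ((\<lambda>s. f s x) has_real_derivative f' s x) (at s)"
    and "\<epsilon> > 0" and g: "integrable M g"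
    and bound: "\<And>s x. \<bar>s - t\<bar> < \<epsilon> \<Longrightarrow> \<bar>f' s x\<bar> \<le> g x"
  shows "((\<lambda>s. \<integral>x. f s x \<partial>M) has_real_derivative (\<integral>x. f' t x \<partial>M)) (at t)"
proof -
  have q_lim: "(\<lambda>n. (f (t + h n) x - f t x) / h n) \<longlonglongrightarrow> f' t x"
    if "h \<longlonglongrightarrow> 0" "\<And>n. h n \<noteq> 0" for h x
  proof -
    have "((\<lambda>h. (f (t + h) x - f t x) / h) \<longlongrightarrow> f' t x) (at 0)"
      using f'[where x = x and s = t] by (simp add: DERIV_def)
    then show ?thesis
      by (rule filterlim_compose) (use that in \<open>auto simp: filterlim_at\<close>)
  qed
  have q_bound: "\<bar>(f (t + h) x - f t x) / h\<bar> \<le> g x" if h: "h \<noteq> 0" "\<bar>h\<bar> < \<epsilon>" for h x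
  proof -
    have "\<exists>z. \<bar>z - t\<bar> < \<epsilon> \<and> f (t + h) x - f t x = h * f' z x"
    proof (cases "h > 0")
      case True
      then show ?thesis using MVT2[of t "t + h" "\<lambda>s. f s x" "\<lambda>s. f' s x"] f' h by force
    next
      case False
      then have "t + h < t" using h by simp
      from MVT2[OF this, of "\<lambda>s. f s x" "\<lambda>s. f' s x"] f'
      obtain z where z: "t + h < z" "z < t" "f t x - f (t + h) x = (t - (t + h)) * f' z x" by blast
      then show ?thesis using h False by (intro exI[of _ z]) auto
    qed
    then obtain z where "\<bar>z - t\<bar> < \<epsilon>" "f (t + h) x - f t x = h * f' z x" by blast
    then show ?thesis using bound[of z x] h by simp
  qed
  \<comment> \<open>Measurability of the derivative is inherited from the difference quotients with
    steps 1/(n+1), whose pointwise limit it is.\<close>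
  have meas: "f' t \<in> borel_measurable M"
  proof (rule borel_measurable_LIMSEQ_real)
    fix x
    show "(\<lambda>n. (f (t + inverse (real (Suc n))) x - f t x) / inverse (real (Suc n))) \<longlonglongrightarrow> f' t x"
      by (rule q_lim) (auto simp: LIMSEQ_inverse_real_of_nat simp del: of_nat_Suc)
  qed (use int in measurable)
  have quot: "((\<integral>x. f (t + h) x \<partial>M) - (\<integral>x. f t x \<partial>M)) / h = (\<integral>x. (f (t + h) x - f t x) / h \<partial>M)" for h
    using int by simp
  show "((\<lambda>s. \<integral>x. f s x \<partial>M) has_real_derivative (\<integral>x. f' t x \<partial>M)) (at t)"
    unfolding DERIV_def quot
    tendsto_at_iff_sequentially
  proof (intro allI impI)
    fix h :: "nat \<Rightarrow> real" assume h: "\<forall>i. h i \<in> UNIV - {0}" "h \<longlonglongrightarrow> 0"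
    \<comment> \<open>The bound holds only for steps below \<epsilon>, so the first \<open>N\<close>
      terms of the sequence are dropped and restored at the end by
      \<open>LIMSEQ_offset\<close>.\<close>
    from h(2) \<open>\<epsilon> > 0\<close> obtain N where N: "\<And>n. n \<ge> N \<Longrightarrow> \<bar>h n\<bar> < \<epsilon>"
      unfolding LIMSEQ_iff by force
    let ?k = "\<lambda>n. h (n + N)"
    have k: "?k \<longlonglongrightarrow> 0" "\<And>n. ?k n \<noteq> 0" "\<And>n. \<bar>?k n\<bar> < \<epsilon>"
      using h N by (auto intro: LIMSEQ_ignore_initial_segment)
    have "(\<lambda>n. \<integral>x. (f (t + ?k n) x - f t x) / ?k n \<partial>M) \<longlonglongrightarrow> (\<integral>x. f' t x \<partial>M)"
      by (rule integral_dominated_convergence[OF meas _ g])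
         (use int k q_lim[OF k(1,2)] q_bound in \<open>auto intro!: AE_I2\<close>)
    then show "((\<lambda>h. \<integral>x. (f (t + h) x - f t x) / h \<partial>M) \<circ> h) \<longlonglongrightarrow> (\<integral>x. f' t x \<partial>M)"
      unfolding o_def by (rule LIMSEQ_offset)
  qed
qed

section \<open>Leibniz and linearity rules, and the classes \<open>Ck\<close>\<close>

lemma dird_bounded_bilinear:
  assumes P: "bounded_bilinear P" and f: "f differentiable (at x)" and g: "g differentiable (at x)"
  shows "dird b (\<lambda>x. P (f x) (g x)) x = P (dird b f x) (g x) + P (f x) (dird b g x)"
proof -
  obtain f' g' where f': "(f has_derivative f') (at x)" and g': "(g has_derivative g') (at x)"
    using f g unfolding differentiable_def by blast
  show ?thesis
    unfolding dird_eq[OF f'] dird_eq[OF g'] dird_eq[OF bounded_bilinear.FDERIV[OF P f' g']]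
    by simp
qed

lemma bounded_bilinear_differentiable:
  "bounded_bilinear P \<Longrightarrow> f differentiable (at x) \<Longrightarrow> g differentiable (at x) \<Longrightarrow>
    (\<lambda>x. P (f x) (g x)) differentiable (at x)"
  unfolding differentiable_def using bounded_bilinear.FDERIV by blast

lemma dird_sum:
  assumes "\<And>i. i \<in> I \<Longrightarrow> f i differentiable (at x)"
  shows "dird b (\<lambda>x. \<Sum>i\<in>I. f i x) x = (\<Sum>i\<in>I. dird b (f i) x)"
proof -
  obtain f' where f': "\<And>i. i \<in> I \<Longrightarrow> (f i has_derivative f' i) (at x)"
    using assms unfolding differentiable_def by metis
  then have "((\<lambda>x. \<Sum>i\<in>I. f i x) has_derivative (\<lambda>h. \<Sum>i\<in>I. f' i h)) (at x)"
    by (rule has_derivative_sum)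
  from dird_eq[OF this] show ?thesis
    using dird_eq[OF f'] by simp
qed

lemma dird_add:
  assumes "f differentiable (at x)" "g differentiable (at x)"
  shows "dird b (\<lambda>x. f x + g x) x = dird b f x + dird b g x"
proof -
  obtain f' g' where f': "(f has_derivative f') (at x)" and g': "(g has_derivative g') (at x)"
    using assms unfolding differentiable_def by blast
  show ?thesis
    unfolding dird_eq[OF f'] dird_eq[OF g'] dird_eq[OF has_derivative_add[OF f' g']] ..
qed

lemma dird_diff:
  assumes "f differentiable (at x)" "g differentiable (at x)"
  shows "dird b (\<lambda>x. f x - g x) x = dird b f x - dird b g x"
proof -
  obtain f' g' where f': "(f has_derivative f') (at x)" and g': "(g has_derivative g') (at x)"
    using assms unfolding differentiable_def by blast
  show ?thesis
    unfolding dird_eq[OF f'] dird_eq[OF g'] dird_eq[OF has_derivative_diff[OF f' g']] ..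
qed

lemma Ck_SucD: "Ck (Suc k) f \<Longrightarrow> Ck k f"
proof (induction k arbitrary: f)
  case 0
  then show ?case using Ck_imp_continuous[of "Suc 0" f] by simp
qed auto

lemma Ck_bounded_linear:
  assumes L: "bounded_linear L"
  shows "Ck k f \<Longrightarrow> Ck k (\<lambda>x. L (f x))"
proof (induction k arbitrary: f)
  case 0
  then show ?case
    using bounded_linear.continuous_on[OF L] by simp
next
  case (Suc k)
  then have d: "\<And>x. f differentiable (at x)" by simp
  have "dird b (\<lambda>x. L (f x)) = (\<lambda>x. L (dird b f x))" for b
    using dird_bounded_linear[OF L d] by auto
  with Suc d show ?case
    using bounded_linear_differentiable[OF L d] by simp
qed

lemma Ck_pd: "Ck (Suc k) f \<Longrightarrow> Ck k (pd i f)"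
  by (simp add: pd_def)

lemma pd_commute:
  fixes f :: "real^'n::finite \<Rightarrow> 'b::euclidean_space"
  shows "Ck 2 f \<Longrightarrow> pd i (pd j f) x = pd j (pd i f) x"
  unfolding pd_def by (rule dird_commute) auto

section \<open>Time and space derivatives of functions on space-time\<close>

lemma dird_snd: "dird (0, b) (\<lambda>(t, x). u t x) = (\<lambda>(t, x). dird b (u t) x)"
  by (auto simp: dird_def fun_eq_iff)

text \<open>\<open>vector_derivative\<close> is a choice among all candidates, so showing that both
  sides have the same candidates \<open>v\<close> makes them equal, whether or not a derivative
  exists.\<close>

lemma vector_derivative_shift:
  "vector_derivative (\<lambda>s. f (t + s)) (at 0) = vector_derivative f (at (t::real))"
proof -
  have "((\<lambda>s. f (t + s)) has_vector_derivative v) (at 0) \<longleftrightarrow> (f has_vector_derivative v) (at t)" for v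
  proof
    assume *: "((\<lambda>s. f (t + s)) has_vector_derivative v) (at 0)"
    have "((\<lambda>s. s - t) has_vector_derivative 1) (at t)"
      by (auto intro!: derivative_eq_intros)
    from vector_diff_chain_at[OF this, of "\<lambda>s. f (t + s)" v] * show "(f has_vector_derivative v) (at t)"
      by (simp add: o_def)
  next
    assume *: "(f has_vector_derivative v) (at t)"
    have "((\<lambda>s. t + s) has_vector_derivative 1) (at 0)"
      by (auto intro!: derivative_eq_intros)
    from vector_diff_chain_at[OF this, of f v] * show "((\<lambda>s. f (t + s)) has_vector_derivative v) (at 0)"
      by (simp add: o_def)
  qed
  then show ?thesis by (simp add: vector_derivative_def)
qed

lemma dird_fst: "dird (1, 0) (\<lambda>(t, x). u t x) = (\<lambda>(t, x). dt u t x)"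
  unfolding dird_def dt_def fun_eq_iff
  using vector_derivative_shift[of "\<lambda>s. u s x" t for x t] by auto

lemma differentiable_slice:
  assumes "(\<lambda>(t, x). u t x) differentiable (at (t, x))"
  shows "u t differentiable (at x)"
proof -
  obtain f' where f': "((\<lambda>(t, x). u t x) has_derivative f') (at (t, x))"
    using assms unfolding differentiable_def by blast
  have "((\<lambda>y. (t, y)) has_derivative (\<lambda>h. (0, h))) (at x)"
    by (auto intro!: derivative_eq_intros)
  from diff_chain_at[OF this f'] show ?thesis
    by (auto simp: o_def differentiable_def)
qed

text \<open>Regularity of \<open>u\<close> is assumed jointly in (t, x). The vectors (0, b) belong
  to the basis of the product space, and by \<open>dird_snd\<close> differentiating along them is
  differentiating the slice, so the induction passes from \<open>u\<close> to its spatial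
  derivatives.\<close>

lemma Ck_slice: "Ck k (\<lambda>(t, x). u t x) \<Longrightarrow> Ck k (u t)"
proof (induction k arbitrary: u)
  case 0
  then have "continuous_on UNIV ((\<lambda>(t, x). u t x) \<circ> (\<lambda>x. (t, x)))"
    by (intro continuous_on_compose) (auto intro!: continuous_intros intro: continuous_on_subset)
  then show ?case by (simp add: o_def)
next
  case (Suc k)
  have "Ck k (dird b (u t))" if "b \<in> Basis" for b
  proof -
    have "(0, b) \<in> Basis" using that by (simp add: Basis_prod_def)
    then have "Ck k (dird (0, b) (\<lambda>(t, x). u t x))" using Suc.prems by auto
    then show ?thesis unfolding dird_snd by (rule Suc.IH)
  qed
  moreover have "u t differentiable (at x)" for x
    using Suc.prems by (auto intro: differentiable_slice[where t = t])
  ultimately show ?case by simp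
qed

lemma Ck_pd_joint: "Ck (Suc k) (\<lambda>(t, x). u t x) \<Longrightarrow> Ck k (\<lambda>(t, x). pd i (u t) x)"
  unfolding pd_def dird_snd[symmetric] by (auto simp: Basis_prod_def)

lemma Ck_dt: "Ck (Suc k) (\<lambda>(t, x). u t x) \<Longrightarrow> Ck k (\<lambda>(t, x). dt u t x)"
  unfolding dird_fst[symmetric] by (auto simp: Basis_prod_def)

lemma has_vector_derivative_dt:
  assumes "Ck (Suc k) (\<lambda>(t, x). u t x)"
  shows "((\<lambda>s. u s x) has_vector_derivative dt u t x) (at t)"
  using has_vector_derivative_along_line[of "\<lambda>(t, x). u t x" "(0, x)" t "(1, 0)"] assms
  by (simp add: dird_fst)

text \<open>This is symmetry of second derivatives on space-time, for the basis directions (1, 0)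
  and (0, axis i 1).\<close>

lemma dt_pd_commute:
  fixes u :: "real \<Rightarrow> real^'n::finite \<Rightarrow> 'b::euclidean_space"
  assumes "Ck 2 (\<lambda>(t, x). u t x)"
  shows "dt (\<lambda>t. pd i (u t)) t x = pd i (dt u t) x"
proof -
  have "dird (1, 0) (dird (0, axis i 1) (\<lambda>(t, x). u t x)) (t, x)
      = dird (0, axis i 1) (dird (1, 0) (\<lambda>(t, x). u t x)) (t, x)"
    by (rule dird_commute[OF assms]) (auto simp: Basis_prod_def)
  then show ?thesis
    unfolding dird_snd dird_fst pd_def by simp
qed

section \<open>Magnetic derivatives and Dirac matrices\<close>

text \<open>Only real parts enter the pointwise computation. This rule moves it to the real inner
  product, which is symmetric and so merges the two halves of each Leibniz rule.\<close>

lemma Re_cinner: "Re (cinner a b) = a \<bullet> b"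
  by (simp add: cinner_def inner_vec_def inner_complex_def)

lemma cinner_add_left: "cinner (a + b) c = cinner a c + cinner b c"
  and cinner_add_right: "cinner c (a + b) = cinner c a + cinner c b"
  and cinner_scale_left: "cinner (z *s a) c = z * cinner a c"
  and cinner_scale_right: "cinner c (z *s a) = cnj z * cinner c a"
  by (simp_all add: cinner_def algebra_simps sum.distrib sum_distrib_left)

lemma cinner_diff_left: "cinner (a - b) c = cinner a c - cinner b c"
  and cinner_diff_right: "cinner c (a - b) = cinner c a - cinner c b"
  by (simp_all add: cinner_def algebra_simps sum_subtractf)

lemma cnj_cinner: "cnj (cinner a b) = cinner b a"
  by (simp add: cinner_def mult.commute)

lemma cinner_self: "cinner a a = complex_of_real ((norm a)\<^sup>2)"
  unfolding complex_eq_iff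
  by (simp add: Re_cinner power2_norm_eq_inner) (simp add: cinner_def mult.commute)

lemma scaleR_eq_vector_scale: "r *\<^sub>R (a :: complex^'m::finite) = complex_of_real r *s a"
  by (simp add: vec_eq_iff scaleR_conv_of_real[where 'a = complex])

lemma bounded_bilinear_cinner: "bounded_bilinear (cinner :: complex^'m::finite \<Rightarrow> _)"
proof
  show "\<exists>K. \<forall>a b :: complex^'m. norm (cinner a b) \<le> norm a * norm b * K"
  proof (intro exI allI)
    fix a b :: "complex^'m"
    have "norm (cinner a b) \<le> (\<Sum>l\<in>(UNIV::'m set). norm a * norm b)"
      unfolding cinner_def
      by (rule sum_norm_le) (simp add: norm_mult mult_mono Finite_Cartesian_Product.norm_nth_le)
    then show "norm (cinner a b) \<le> norm a * norm b * real CARD('m)"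
      by (simp add: mult.commute)
  qed
qed (simp_all add: cinner_add_left cinner_add_right scaleR_eq_vector_scale
      cinner_scale_left cinner_scale_right scaleR_conv_of_real[where 'a = complex])

lemma bounded_bilinear_vector_scale: "bounded_bilinear ((*s) :: complex \<Rightarrow> complex^'m::finite \<Rightarrow> _)"
proof
  show "\<exists>K. \<forall>z (b :: complex^'m). norm (z *s b) \<le> norm z * norm b * K"
  proof (intro exI allI)
    fix z and b :: "complex^'m"
    have "norm (z *s b) \<le> norm (norm z *\<^sub>R b)"
      by (rule norm_le_componentwise_cart) (simp add: norm_mult)
    then show "norm (z *s b) \<le> norm z * norm b * 1"
      by simp
  qed
qed (simp_all add: vec_eq_iff distrib_left distrib_right)

lemma bounded_linear_matrix_vector: "bounded_linear ((*v) (X :: complex^'k::finite^'m::finite))"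
  by (simp add: linear_conv_bounded_linear[symmetric] linear_iff matrix_vector_right_distrib
        scaleR_eq_vector_scale vector_scalar_commute)

lemma cinner_hermitian:
  assumes "hermitian X"
  shows "cinner (X *v a) b = cinner a (X *v b)"
proof -
  have "cinner (X *v a) b = (\<Sum>i\<in>UNIV. \<Sum>j\<in>UNIV. X $ i $ j * a $ j * cnj (b $ i))"
    by (simp add: cinner_def matrix_vector_mult_def sum_distrib_right)
  also have "\<dots> = (\<Sum>j\<in>UNIV. \<Sum>i\<in>UNIV. X $ i $ j * a $ j * cnj (b $ i))"
    by (rule sum.swap)
  also have "\<dots> = (\<Sum>j\<in>UNIV. \<Sum>i\<in>UNIV. a $ j * cnj (X $ j $ i * b $ i))"
  proof (intro sum.cong refl)
    fix i j
    have "X $ i $ j = cnj (X $ j $ i)" using assms unfolding hermitian_def by blast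
    then show "X $ i $ j * a $ j * cnj (b $ i) = a $ j * cnj (X $ j $ i * b $ i)"
      by (simp only: complex_cnj_mult mult_ac)
  qed
  also have "\<dots> = cinner a (X *v b)"
    by (simp add: cinner_def matrix_vector_mult_def sum_distrib_left)
  finally show ?thesis .
qed

lemma mat_vector_mult: "mat c *v a = c *s (a :: complex^'m::finite)"
proof -
  have "(\<Sum>j\<in>UNIV. (if i = j then c else 0) * a $ j) = c * a $ i" for i
  proof -
    have "(\<Sum>j\<in>UNIV. (if i = j then c else 0) * a $ j) = (\<Sum>j\<in>UNIV. if i = j then c * a $ j else 0)"
      by (intro sum.cong) auto
    then show ?thesis by simp
  qed
  then show ?thesis
    by (simp add: vec_eq_iff matrix_vector_mult_def mat_def)
qed

lemma bounded_linear_imaginary: "bounded_linear (\<lambda>r. \<i> * complex_of_real r)"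
  by (intro bounded_linear_const_mult bounded_linear_of_real)

lemma bounded_linear_vector_scale: "bounded_linear (\<lambda>a. z *s (a :: complex^'m::finite))"
  by (rule bounded_bilinear.bounded_linear_right[OF bounded_bilinear_vector_scale])

section \<open>Covariant derivatives: commutators and Leibniz rules\<close>

context
  fixes A :: "real^'n::finite \<Rightarrow> real^'n"
  assumes A: "\<And>x. A differentiable (at x)"
begin

lemma potential_differentiable:
  "(\<lambda>x. A x $ k) differentiable (at x)"
  "(\<lambda>x. \<i> * complex_of_real (A x $ k)) differentiable (at x)"
  by (intro bounded_linear_differentiable[OF bounded_linear_imaginary]
      bounded_linear_differentiable[OF bounded_linear_vec_nth] A)+

lemma covd_differentiable:
  assumes "Ck 2 f"
  shows "covd A k f differentiable (at x)"
proof -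
  have "pd k f differentiable (at x)" "f differentiable (at x)"
    using assms by (simp_all add: numeral_2_eq_2 pd_def)
  then show ?thesis
    unfolding covd_def
    by (intro differentiable_diff bounded_bilinear_differentiable[OF bounded_bilinear_vector_scale]
        potential_differentiable)
qed

text \<open>The expansion isolates what fails to be symmetric in \<open>j\<close> and
  \<open>k\<close>: once second partial derivatives of \<open>f\<close> commute, this is only the
  term with the derivative of the potential, and its antisymmetric part is the magnetic
  field.\<close>

lemma covd_covd:
  assumes "Ck 2 f"
  shows "covd A j (covd A k f) x = pd j (pd k f) x - (\<i> * complex_of_real (pd j (\<lambda>x. A x $ k) x)) *s f x
     - (\<i> * complex_of_real (A x $ k)) *s pd j f x - (\<i> * complex_of_real (A x $ j)) *s pd k f x
     - complex_of_real (A x $ j * A x $ k) *s f x"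
proof -
  have f: "pd k f differentiable (at x)" "f differentiable (at x)"
    using assms by (simp_all add: numeral_2_eq_2 pd_def)
  have "pd j (covd A k f) x = pd j (pd k f) x -
      ((\<i> * complex_of_real (pd j (\<lambda>x. A x $ k) x)) *s f x + (\<i> * complex_of_real (A x $ k)) *s pd j f x)"
    unfolding covd_def pd_def
    using f potential_differentiable
    by (simp add: dird_diff dird_bounded_bilinear[OF bounded_bilinear_vector_scale] pd_def
        bounded_bilinear_differentiable[OF bounded_bilinear_vector_scale]
        dird_bounded_linear[OF bounded_linear_imaginary])
  then show ?thesis
    unfolding covd_def[of A j]
    by (simp add: covd_def vec_eq_iff algebra_simps)
qed

lemma covd_commutator:
  assumes "Ck 2 f"
  shows "covd A j (covd A k f) x = covd A k (covd A j f) x + (\<i> * complex_of_real (magB A j k x)) *s f x"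
  unfolding covd_covd[OF assms] magB_def pd_commute[OF assms, of j k]
  by (simp add: vec_eq_iff algebra_simps)

end

text \<open>The potential is real, so it contributes -iA and +iA to the two slots, the second one
  being conjugated; the contributions cancel, whatever \<open>A\<close> is.\<close>

lemma pd_cinner:
  assumes "f differentiable (at x)" "g differentiable (at x)"
  shows "pd l (\<lambda>x. cinner (f x) (g x)) x = cinner (covd A l f x) (g x) + cinner (f x) (covd A l g x)"
proof -
  have "pd l (\<lambda>x. cinner (f x) (g x)) x = cinner (pd l f x) (g x) + cinner (f x) (pd l g x)"
    unfolding pd_def by (rule dird_bounded_bilinear[OF bounded_bilinear_cinner assms])
  then show ?thesis
    unfolding covd_def by (simp add: cinner_diff_left cinner_diff_right cinner_scale_left cinner_scale_right)
qed

lemma pd_mult: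
  fixes f g :: "_ \<Rightarrow> real"
  assumes "f differentiable (at x)" "g differentiable (at x)"
  shows "pd l (\<lambda>x. f x * g x) x = pd l f x * g x + f x * pd l g x"
  using assms by (simp add: pd_def dird_bounded_bilinear[OF bounded_bilinear_mult])

lemma cinner_differentiable:
  "f differentiable (at x) \<Longrightarrow> g differentiable (at x) \<Longrightarrow> (\<lambda>x. cinner (f x) (g x)) differentiable (at x)"
  by (rule bounded_bilinear_differentiable[OF bounded_bilinear_cinner])

lemma of_real_differentiable:
  "a differentiable (at x) \<Longrightarrow> (\<lambda>x. complex_of_real (a x)) differentiable (at x)"
  by (rule bounded_linear_differentiable[OF bounded_linear_of_real])

lemma weighted_cinner_differentiable:
  assumes "a differentiable (at x)" "f differentiable (at x)" "g differentiable (at x)"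
  shows "(\<lambda>x. complex_of_real (a x) * cinner (f x) (g x)) differentiable (at x)"
  using assms by (intro differentiable_mult of_real_differentiable cinner_differentiable)

text \<open>All fields integrated by parts have this shape: a real weight times a hermitian product,
  with |f|^2 read as \<open>cinner f f\<close>.\<close>

lemma pd_weighted_cinner:
  assumes "a differentiable (at x)" "f differentiable (at x)" "g differentiable (at x)"
  shows "pd l (\<lambda>x. complex_of_real (a x) * cinner (f x) (g x)) x =
    complex_of_real (pd l a x) * cinner (f x) (g x) +
    complex_of_real (a x) * (cinner (covd A l f x) (g x) + cinner (f x) (covd A l g x))"
proof -
  have "pd l (\<lambda>x. complex_of_real (a x) * cinner (f x) (g x)) x =
     pd l (\<lambda>x. complex_of_real (a x)) x * cinner (f x) (g x) +
     complex_of_real (a x) * pd l (\<lambda>x. cinner (f x) (g x)) x"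
    using assms unfolding pd_def
    by (subst dird_bounded_bilinear[OF bounded_bilinear_mult])
       (auto simp: of_real_differentiable cinner_differentiable)
  then show ?thesis
    using assms(1) unfolding pd_cinner[OF assms(2,3), where A = A]
    by (simp add: pd_def dird_bounded_linear[OF bounded_linear_of_real])
qed

section \<open>The Dirac operator and its square\<close>

lemma covd_matrix_vector:
  "f differentiable (at x) \<Longrightarrow> covd A k (\<lambda>y. X *v f y) x = X *v covd A k f x"
  by (simp add: covd_def pd_def dird_bounded_linear[OF bounded_linear_matrix_vector]
      matrix_vector_mult_diff_distrib vector_scalar_commute)

lemma covd_vector_scale:
  "f differentiable (at x) \<Longrightarrow> covd A k (\<lambda>y. z *s f y) x = z *s covd A k f x"
  by (simp add: covd_def pd_def dird_bounded_linear[OF bounded_linear_vector_scale] vec_eq_iff algebra_simps)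

lemma covd_add:
  "f differentiable (at x) \<Longrightarrow> g differentiable (at x) \<Longrightarrow>
    covd A k (\<lambda>y. f y + g y) x = covd A k f x + covd A k g x"
  by (simp add: covd_def pd_def dird_add vec_eq_iff algebra_simps)

lemma covd_sum:
  "(\<And>i. i \<in> I \<Longrightarrow> f i differentiable (at x)) \<Longrightarrow>
    covd A k (\<lambda>y. \<Sum>i\<in>I. f i y) x = (\<Sum>i\<in>I. covd A k (f i) x)"
  by (simp add: covd_def pd_def dird_sum vec_eq_iff sum_distrib_left sum_subtractf)

text \<open>Multiplication by i absorbs the factor \<open>inverse \<i>\<close>, so the flow u_t = i
  H u has no scalar in front of its derivative part; i H rather than H is therefore the operator
  squared below.\<close>

lemma dirac_op_imaginary:
  "\<i> *s dirac_op A m \<beta> \<alpha> f x =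
    (\<Sum>k\<in>UNIV. \<alpha> k *v covd A k f x) + (\<i> * complex_of_real m) *s (\<beta> *v f x)"
  by (simp add: dirac_op_def vec_eq_iff distrib_left)

lemma magB_swap: "magB A k j x = - magB A j k x"
  by (simp add: magB_def)

text \<open>The symmetric part of \<alpha>_k \<alpha>_j is the identity for j = k and 0 otherwise,
  so only the trace of \<open>X\<close> and its antisymmetric part survive. The doubled form avoids
  halving vectors: the sum over all pairs counts each j < k twice.\<close>

lemma sum_dirac_products:
  assumes dirac: "dirac_matrices \<beta> (\<alpha> :: 'n::finite \<Rightarrow> complex^'m::finite^'m)"
  shows "2 *s (\<Sum>k\<in>UNIV. \<Sum>j\<in>UNIV. (\<alpha> k ** \<alpha> j) *v X k j) =
    2 *s (\<Sum>k\<in>UNIV. X k k) + (\<Sum>j\<in>UNIV. \<Sum>k\<in>UNIV. (\<alpha> j ** \<alpha> k) *v (X j k - X k j))"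
proof -
  have anti: "(\<alpha> k ** \<alpha> j) *v y + (\<alpha> j ** \<alpha> k) *v y = (if k = j then 2 *s y else 0)" for j k y
  proof -
    have "(\<alpha> k ** \<alpha> j) *v y + (\<alpha> j ** \<alpha> k) *v y = (\<alpha> k ** \<alpha> j + \<alpha> j ** \<alpha> k) *v y"
      by (simp add: matrix_vector_mult_add_rdistrib)
    also have "\<alpha> k ** \<alpha> j + \<alpha> j ** \<alpha> k = (if k = j then mat 2 else 0)"
      using dirac unfolding dirac_matrices_def by blast
    finally show ?thesis by (simp add: mat_vector_mult)
  qed
  let ?S = "\<Sum>k\<in>UNIV. \<Sum>j\<in>UNIV. (\<alpha> k ** \<alpha> j) *v X k j"
  have swap: "?S = (\<Sum>k\<in>UNIV. \<Sum>j\<in>UNIV. (\<alpha> j ** \<alpha> k) *v X j k)"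
    by (rule sum.swap)
  \<comment> \<open>One copy of the sum of \<alpha>_j \<alpha>_k X_kj is added and one subtracted.
    The added copy completes the anticommutator in the first \<open>?S\<close>; the subtracted one
    combines with the second \<open>?S\<close>, its indices exchanged by \<open>swap\<close>, to the
    difference X_jk - X_kj.\<close>
  have "2 *s ?S = ?S + (\<Sum>k\<in>UNIV. \<Sum>j\<in>UNIV. (\<alpha> j ** \<alpha> k) *v X k j)
       - (\<Sum>k\<in>UNIV. \<Sum>j\<in>UNIV. (\<alpha> j ** \<alpha> k) *v X k j) + ?S"
    by (simp add: vec_eq_iff)
  also have "\<dots> = (\<Sum>k\<in>UNIV. \<Sum>j\<in>UNIV. (\<alpha> k ** \<alpha> j) *v X k j + (\<alpha> j ** \<alpha> k) *v X k j) +
       (\<Sum>k\<in>UNIV. \<Sum>j\<in>UNIV. (\<alpha> j ** \<alpha> k) *v (X j k - X k j))"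
    by (subst (2) swap) (simp add: sum.distrib sum_subtractf matrix_vector_mult_diff_distrib)
  also have "(\<Sum>k\<in>UNIV. \<Sum>j\<in>UNIV. (\<alpha> k ** \<alpha> j) *v X k j + (\<alpha> j ** \<alpha> k) *v X k j) =
      2 *s (\<Sum>k\<in>UNIV. X k k)"
    by (simp add: anti vec.scale_sum_right)
  also have "(\<Sum>k\<in>UNIV. \<Sum>j\<in>UNIV. (\<alpha> j ** \<alpha> k) *v (X j k - X k j)) =
      (\<Sum>j\<in>UNIV. \<Sum>k\<in>UNIV. (\<alpha> j ** \<alpha> k) *v (X j k - X k j))"
    by (rule sum.swap)
  finally show ?thesis .
qed

text \<open>The cross terms between mass and derivatives cancel because \<beta> anticommutes with
  every \<alpha>_k, and \<beta>^2 = 1 leaves (im)^2 = -m^2. In the derivative part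
  \<open>sum_dirac_products\<close> turns the antisymmetrised second derivatives into commutators,
  that is, into the magnetic field.\<close>

lemma dirac_op_squared:
  fixes A :: "real^'n::finite \<Rightarrow> real^'n" and \<alpha> :: "'n \<Rightarrow> complex^'m::finite^'m"
  assumes A: "\<And>x. A differentiable (at x)" and f: "Ck 2 f"
    and dirac: "dirac_matrices \<beta> \<alpha>"
  shows "2 *s (\<i> *s dirac_op A m \<beta> \<alpha> (\<lambda>y. \<i> *s dirac_op A m \<beta> \<alpha> f y) x) =
    2 *s (\<Sum>j\<in>UNIV. covd A j (covd A j f) x) - complex_of_real (2 * m\<^sup>2) *s f x +
    (\<Sum>j\<in>UNIV. \<Sum>k\<in>UNIV. (\<i> * complex_of_real (magB A j k x)) *s ((\<alpha> j ** \<alpha> k) *v f x))"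
proof -
  have df: "f differentiable (at x)" for x using f by (simp add: numeral_2_eq_2)
  note dD = covd_differentiable[OF A f]
  note lin = bounded_linear_differentiable[OF bounded_linear_matrix_vector]
     bounded_linear_differentiable[OF bounded_linear_vector_scale]
  let ?c = "\<i> * complex_of_real m"
  let ?v = "\<lambda>y. \<i> *s dirac_op A m \<beta> \<alpha> f y"
  have dsum: "(\<lambda>y. \<Sum>j\<in>UNIV. \<alpha> j *v covd A j f y) differentiable (at x)"
    by (intro differentiable_sum) (auto intro!: lin dD)
  have covd_v: "covd A k ?v x = (\<Sum>j\<in>UNIV. \<alpha> j *v covd A k (covd A j f) x) + ?c *s (\<beta> *v covd A k f x)" for k
    unfolding dirac_op_imaginary
    by (simp add: covd_add covd_sum covd_matrix_vector covd_vector_scale lin dD df dsum)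
  have anti: "\<alpha> k *v (\<beta> *v y) + \<beta> *v (\<alpha> k *v y) = 0" for k y
  proof -
    have "\<alpha> k *v (\<beta> *v y) + \<beta> *v (\<alpha> k *v y) = (\<alpha> k ** \<beta> + \<beta> ** \<alpha> k) *v y"
      by (simp add: matrix_vector_mul_assoc matrix_vector_mult_add_rdistrib)
    also have "\<alpha> k ** \<beta> + \<beta> ** \<alpha> k = 0"
      using dirac unfolding dirac_matrices_def by blast
    finally show ?thesis by simp
  qed
  have beta: "\<beta> *v (\<beta> *v y) = y" for y
  proof -
    have "(\<beta> ** \<beta>) *v y + (\<beta> ** \<beta>) *v y = 2 *s y"
      using dirac unfolding dirac_matrices_def
      by (simp add: mat_vector_mult matrix_vector_mult_add_rdistrib[symmetric])
    then show ?thesis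
      by (simp add: matrix_vector_mul_assoc vec_eq_iff)
  qed
  let ?D = "\<lambda>k. covd A k f x" and ?DD = "\<lambda>k j. covd A k (covd A j f) x"
  have lsum: "X *v (\<Sum>j\<in>UNIV. g j) = (\<Sum>j\<in>UNIV. X *v g j)" for X :: "complex^'m^'m" and g :: "'n \<Rightarrow> _"
    by (rule linear_sum[OF bounded_linear.linear[OF bounded_linear_matrix_vector]])
  have "\<i> *s dirac_op A m \<beta> \<alpha> ?v x =
     (\<Sum>k\<in>UNIV. \<alpha> k *v ((\<Sum>j\<in>UNIV. \<alpha> j *v ?DD k j) + ?c *s (\<beta> *v ?D k))) +
     ?c *s (\<beta> *v ((\<Sum>k\<in>UNIV. \<alpha> k *v ?D k) + ?c *s (\<beta> *v f x)))"
    unfolding dirac_op_imaginary[of A m \<beta> \<alpha> ?v] covd_v unfolding dirac_op_imaginary ..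
  also have "\<dots> = (\<Sum>k\<in>UNIV. \<Sum>j\<in>UNIV. (\<alpha> k ** \<alpha> j) *v ?DD k j) +
     ?c *s (\<Sum>k\<in>UNIV. \<alpha> k *v (\<beta> *v ?D k) + \<beta> *v (\<alpha> k *v ?D k)) + (?c * ?c) *s f x"
    by (simp add: matrix_vector_right_distrib vector_scalar_commute lsum sum.distrib beta
        matrix_vector_mul_assoc[symmetric] vec.scale_right_distrib vec.scale_sum_right)
  also have "\<dots> = (\<Sum>k\<in>UNIV. \<Sum>j\<in>UNIV. (\<alpha> k ** \<alpha> j) *v ?DD k j) - complex_of_real (m\<^sup>2) *s f x"
    unfolding anti by (simp add: vec_eq_iff power2_eq_square) (simp add: algebra_simps)
  finally have eq: "\<i> *s dirac_op A m \<beta> \<alpha> ?v x = \<dots>" .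
  have "2 *s (\<i> *s dirac_op A m \<beta> \<alpha> ?v x) =
      2 *s (\<Sum>k\<in>UNIV. \<Sum>j\<in>UNIV. (\<alpha> k ** \<alpha> j) *v ?DD k j) - complex_of_real (2 * m\<^sup>2) *s f x"
    unfolding eq by (simp add: vec_eq_iff algebra_simps)
  moreover have "?DD j k - ?DD k j = (\<i> * complex_of_real (magB A j k x)) *s f x" for j k
    using covd_commutator[OF A f, of j k x] by (simp only: add_diff_cancel_left')
  ultimately show ?thesis
    by (simp only: sum_dirac_products[OF dirac, of ?DD] vector_scalar_commute diff_add_eq)
qed

lemma dirac_product_swap:
  assumes "dirac_matrices \<beta> \<alpha>" and "j \<noteq> k"
  shows "(\<alpha> k ** \<alpha> j) *v c = - ((\<alpha> j ** \<alpha> k) *v c)"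
proof -
  have "\<alpha> k ** \<alpha> j + \<alpha> j ** \<alpha> k = 0"
    using assms unfolding dirac_matrices_def by metis
  then show ?thesis
    by (metis add_eq_0_iff2 matrix_vector_mult_0 matrix_vector_mult_add_rdistrib)
qed

lemma cinner_minus_left: "cinner (- a) c = - cinner a c"
  and cinner_minus_right: "cinner c (- a) = - cinner c a"
  by (simp_all add: cinner_def sum_negf)

text \<open>Taking the adjoint reverses the product of the hermitian \<alpha>_j and \<alpha>_k, and
  anticommutation restores the order at the cost of a sign: the product is skew-adjoint. On the
  diagonal it is the identity, hence the restriction to distinct indices.\<close>

lemma cinner_dirac_product:
  assumes dirac: "dirac_matrices \<beta> \<alpha>" and "j \<noteq> k"
  shows "cinner ((\<alpha> j ** \<alpha> k) *v a) c = - cnj (cinner ((\<alpha> j ** \<alpha> k) *v c) a)"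
proof -
  have herm: "hermitian (\<alpha> i)" for i using dirac unfolding dirac_matrices_def by blast
  have "cinner ((\<alpha> j ** \<alpha> k) *v a) c = cinner a ((\<alpha> k ** \<alpha> j) *v c)"
    by (simp add: matrix_vector_mul_assoc[symmetric] cinner_hermitian[OF herm])
  then show ?thesis
    by (simp add: dirac_product_swap[OF assms] cinner_minus_right cnj_cinner)
qed

section \<open>The virial identity\<close>

lemma magB_differentiable:
  assumes "Ck 2 A"
  shows "magB A j k differentiable (at x)"
proof -
  have "Ck 2 (\<lambda>y. A y $ i)" for i
    by (rule Ck_bounded_linear[OF bounded_linear_vec_nth assms])
  then show ?thesis
    unfolding magB_def
    by (intro differentiable_diff) (simp_all add: numeral_2_eq_2 pd_def)
qed

lemma pd_uminus: "f differentiable (at x) \<Longrightarrow> pd l (\<lambda>y. - f y) x = - pd l f x"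
  using dird_bounded_linear[OF bounded_linear_minus[OF bounded_linear_ident]] by (simp add: pd_def)

lemma weight_differentiable:
  assumes "Ck 4 \<phi>"
  shows "pd l \<phi> differentiable (at x)" "lap \<phi> differentiable (at x)"
    "pd l (lap \<phi>) differentiable (at x)"
proof -
  have four: "4 = Suc (Suc (Suc (Suc 0)))" by simp
  have C: "Ck (Suc (Suc 0)) (pd k (pd k \<phi>))" for k
    using assms unfolding four by (intro Ck_pd)
  show "pd l \<phi> differentiable (at x)"
    using assms unfolding four by (simp add: pd_def)
  show "lap \<phi> differentiable (at x)"
    unfolding lap_def using C by (intro differentiable_sum) auto
  have "pd l (lap \<phi>) = (\<lambda>x. \<Sum>k\<in>UNIV. pd l (pd k (pd k \<phi>)) x)"
    unfolding lap_def pd_def[of l] using C by (intro ext dird_sum) auto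
  then show "pd l (lap \<phi>) differentiable (at x)"
    using C by (auto intro!: differentiable_sum simp: pd_def)
qed

text \<open>The terms \<open>pd i \<dots>\<close> on the right form a divergence, hence have integral \<open>0\<close>.\<close>

lemma virial_divergence_form:
  fixes A :: "real^'n::finite \<Rightarrow> real^'n" and \<alpha> :: "'n \<Rightarrow> complex^'m::finite^'m"
  assumes A: "Ck 2 A" and \<phi>: "Ck 4 \<phi>" and f: "Ck 2 f" and v: "\<And>y. v differentiable (at y)"
    and dirac: "dirac_matrices \<beta> \<alpha>"
    and wave: "2 *s w = 2 *s (\<Sum>j\<in>UNIV. covd A j (covd A j f) x) - complex_of_real (2 * m\<^sup>2) *s f x +
      (\<Sum>j\<in>UNIV. \<Sum>k\<in>UNIV. (\<i> * complex_of_real (magB A j k x)) *s ((\<alpha> j ** \<alpha> k) *v f x))"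
  shows "(\<Sum>k\<in>UNIV. 2 * pd k \<phi> x * (w \<bullet> covd A k f x + v x \<bullet> covd A k v x)) + lap \<phi> x * (w \<bullet> f x + v x \<bullet> v x) =
     (\<Sum>k\<in>UNIV. Re (pd k (\<lambda>y. complex_of_real (pd k \<phi> y * (norm (v y))\<^sup>2)) x))
   - (\<Sum>k\<in>UNIV. Re (pd k (\<lambda>y. complex_of_real (m\<^sup>2 * pd k \<phi> y * (norm (f y))\<^sup>2)) x))
   + (\<Sum>j\<in>UNIV. \<Sum>k\<in>UNIV. \<Sum>l\<in>UNIV. Re (\<i> * pd l (\<lambda>y. complex_of_real (pd l \<phi> y * magB A j k y) *
        cinner ((\<alpha> j ** \<alpha> k) *v f y) (f y)) x)) / 2
   + 2 * (\<Sum>j\<in>UNIV. \<Sum>k\<in>UNIV. Re (pd j (\<lambda>y. complex_of_real (pd k \<phi> y) * cinner (covd A j f y) (covd A k f y)) x))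
   - (\<Sum>j\<in>UNIV. \<Sum>k\<in>UNIV. Re (pd k (\<lambda>y. complex_of_real (pd k \<phi> y) * cinner (covd A j f y) (covd A j f y)) x))
   + (\<Sum>j\<in>UNIV. Re (pd j (\<lambda>y. complex_of_real (lap \<phi> y) * cinner (covd A j f y) (f y)) x))
   - (\<Sum>j\<in>UNIV. Re (pd j (\<lambda>y. complex_of_real (pd j (lap \<phi>) y * (norm (f y))\<^sup>2)) x)) / 2
   - 2 * (\<Sum>j\<in>UNIV. \<Sum>k\<in>UNIV. pd j (pd k \<phi>) x * Re (cinner (covd A j f x) (covd A k f x)))
   + (norm (f x))\<^sup>2 * lap (lap \<phi>) x / 2
   - 2 * (\<Sum>j\<in>UNIV. \<Sum>k\<in>UNIV. pd j \<phi> x * magB A j k x * Im (cinner (f x) (covd A k f x)))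
   - (\<Sum>j\<in>UNIV. \<Sum>k\<in>UNIV. \<Sum>l\<in>UNIV. pd l \<phi> x * pd l (magB A j k) x *
        Re (\<i> * cinner ((\<alpha> j ** \<alpha> k) *v f x) (f x))) / 2"
proof -
  have dA: "A differentiable (at y)" for y using A by (simp add: numeral_2_eq_2)
  have df: "f differentiable (at y)" for y using f by (simp add: numeral_2_eq_2)
  note dD = covd_differentiable[OF dA f]
  note d\<phi> = weight_differentiable[OF \<phi>]
  note dB = magB_differentiable[OF A]
  define D where "D k = covd A k f x" for k
  define DD where "DD j k = covd A j (covd A k f) x" for j k
  define E where "E k = covd A k v x" for k
  define p where "p k = pd k \<phi> x" for k
  define P where "P j k = pd j (pd k \<phi>) x" for j k
  define L where "L = lap \<phi> x"
  define b where "b j k = magB A j k x" for j k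
  define M where "M j k y = (\<alpha> j ** \<alpha> k) *v (y :: complex^'m)" for j k y
  have L: "L = (\<Sum>k\<in>UNIV. P k k)" by (simp add: L_def P_def lap_def)
  have comm: "DD j k = DD k j + (\<i> * complex_of_real (b j k)) *s f x" for j k
    unfolding DD_def b_def by (rule covd_commutator[OF dA f])
  have dM: "(\<lambda>y. M j k (f y)) differentiable (at y)" for j k y
    unfolding M_def by (rule bounded_linear_differentiable[OF bounded_linear_matrix_vector df])
  note pdw = pd_weighted_cinner[where A = A] and norm_eq = cinner_self[symmetric]

  define T1 where "T1 k = Re (pd k (\<lambda>y. complex_of_real (pd k \<phi> y * (norm (v y))\<^sup>2)) x)" for k
  have T1: "T1 k = P k k * (v x \<bullet> v x) + 2 * p k * (v x \<bullet> E k)" for k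
    unfolding T1_def of_real_mult norm_eq
    by (subst pdw) (simp_all add: d\<phi> v Re_cinner P_def p_def E_def inner_commute)
  \<comment> \<open>The kinetic part is exactly div(|v|^2 grad \<phi>), since \<open>L\<close> is
    the trace of the Hessian \<open>P\<close>.\<close>
  have kin: "(\<Sum>k\<in>UNIV. 2 * p k * (v x \<bullet> E k)) + L * (v x \<bullet> v x) = (\<Sum>k\<in>UNIV. T1 k)"
    unfolding T1 L sum_distrib_right sum.distrib by (rule add.commute)

  define T2 where "T2 k = Re (pd k (\<lambda>y. complex_of_real (m\<^sup>2 * pd k \<phi> y * (norm (f y))\<^sup>2)) x)" for k
  have pd_cmult: "pd k (\<lambda>y. c * g y) x = c * pd k g x" if "g differentiable (at x)" for c k and g :: "_ \<Rightarrow> real"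
    using that unfolding pd_def by (intro dird_bounded_linear bounded_linear_mult_right)
  have T2: "T2 k = m\<^sup>2 * (P k k * (f x \<bullet> f x) + 2 * p k * (f x \<bullet> D k))" for k
  proof -
    have "T2 k = Re (pd k (\<lambda>y. complex_of_real (m\<^sup>2 * pd k \<phi> y) * cinner (f y) (f y)) x)"
      unfolding T2_def by (simp add: cinner_self)
    then show ?thesis
      by (subst (asm) pdw)
         (simp_all add: pd_cmult d\<phi> df Re_cinner P_def p_def D_def inner_commute,
          simp_all add: algebra_simps Re_cinner)
  qed
  have mass: "(\<Sum>k\<in>UNIV. 2 * p k * (m\<^sup>2 * (f x \<bullet> D k))) + L * (m\<^sup>2 * (f x \<bullet> f x)) = (\<Sum>k\<in>UNIV. T2 k)"
    unfolding T2 L sum_distrib_right sum.distrib[symmetric]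
    by (intro sum.cong refl) (simp add: algebra_simps)

  define T3 where "T3 j k l = Re (\<i> * pd l (\<lambda>y. complex_of_real (pd l \<phi> y * magB A j k y) *
        cinner ((\<alpha> j ** \<alpha> k) *v f y) (f y)) x)" for j k l
  define q where "q j k = Re (\<i> * cinner (M j k (f x)) (f x))" for j k
  define r where "r j k l = Re (\<i> * cinner (M j k (f x)) (D l))" for j k l
  have b_diag: "b j j = 0" for j by (simp add: b_def magB_def)
  \<comment> \<open>The factor \<open>b j k\<close> is kept on both sides because i \<alpha>_j
    \<alpha>_k is hermitian only off the diagonal; on the diagonal the factor vanishes.\<close>
  have herm: "b j k * Re (\<i> * cinner (M j k (D l)) (f x)) = b j k * r j k l" for j k l
  proof (cases "j = k")
    case False
    show ?thesis
      unfolding r_def M_def cinner_dirac_product[OF dirac False, of "D l"] by simp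
  qed (simp add: b_diag)
  have dbp: "(\<lambda>y. pd l \<phi> y * magB A j k y) differentiable (at x)" for l j k
    by (intro differentiable_mult d\<phi> dB)
  have pdbp: "pd l (\<lambda>y. pd l \<phi> y * magB A j k y) x = P l l * b j k + p l * pd l (magB A j k) x" for l j k
    by (simp add: pd_mult d\<phi> dB P_def p_def b_def)
  have T3: "T3 j k l = (P l l * b j k + p l * pd l (magB A j k) x) * q j k + 2 * p l * (b j k * r j k l)" for j k l
  proof -
    have "T3 j k l = (P l l * b j k + p l * pd l (magB A j k) x) * q j k +
      p l * (b j k * Re (\<i> * cinner (M j k (D l)) (f x)) + b j k * r j k l)"
      unfolding T3_def M_def[symmetric]
      by (subst pdw[OF dbp dM df])
         (simp add: pdbp, simp add: q_def r_def D_def M_def covd_matrix_vector[OF df] p_def b_def algebra_simps)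
    then show ?thesis unfolding herm by (simp add: algebra_simps)
  qed
  \<comment> \<open>Compared with the kinetic part, the weight now contains the field, and the
    derivative falling on it leaves the subtracted sum with the gradient of B.\<close>
  have mag: "(\<Sum>l\<in>UNIV. 2 * p l * (\<Sum>j\<in>UNIV. \<Sum>k\<in>UNIV. b j k * r j k l)) +
        L * (\<Sum>j\<in>UNIV. \<Sum>k\<in>UNIV. b j k * q j k) =
      (\<Sum>j\<in>UNIV. \<Sum>k\<in>UNIV. \<Sum>l\<in>UNIV. T3 j k l) -
      (\<Sum>j\<in>UNIV. \<Sum>k\<in>UNIV. \<Sum>l\<in>UNIV. p l * pd l (magB A j k) x * q j k)"
  proof -
    have "(\<Sum>l\<in>UNIV. 2 * p l * (\<Sum>j\<in>UNIV. \<Sum>k\<in>UNIV. b j k * r j k l))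
        = (\<Sum>l\<in>UNIV. \<Sum>j\<in>UNIV. \<Sum>k\<in>UNIV. 2 * p l * (b j k * r j k l))"
      by (simp add: sum_distrib_left)
    also have "\<dots> = (\<Sum>j\<in>UNIV. \<Sum>l\<in>UNIV. \<Sum>k\<in>UNIV. 2 * p l * (b j k * r j k l))"
      by (rule sum.swap)
    also have "\<dots> = (\<Sum>j\<in>UNIV. \<Sum>k\<in>UNIV. \<Sum>l\<in>UNIV. 2 * p l * (b j k * r j k l))"
      by (rule sum.cong[OF refl sum.swap])
    finally have 1: "(\<Sum>l\<in>UNIV. 2 * p l * (\<Sum>j\<in>UNIV. \<Sum>k\<in>UNIV. b j k * r j k l)) = \<dots>" .
    have 2: "L * (\<Sum>j\<in>UNIV. \<Sum>k\<in>UNIV. b j k * q j k) = (\<Sum>j\<in>UNIV. \<Sum>k\<in>UNIV. \<Sum>l\<in>UNIV. P l l * b j k * q j k)"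
      by (simp add: L sum_distrib_left sum_distrib_right mult.assoc)
    show ?thesis
      unfolding 1 2 T3 sum_subtractf[symmetric] sum.distrib[symmetric]
      by (intro sum.cong refl) (simp add: algebra_simps)
  qed

  define T4 where "T4 j k = Re (pd j (\<lambda>y. complex_of_real (pd k \<phi> y) * cinner (covd A j f y) (covd A k f y)) x)" for j k
  define T5 where "T5 j k = Re (pd k (\<lambda>y. complex_of_real (pd k \<phi> y) * cinner (covd A j f y) (covd A j f y)) x)" for j k
  define T6 where "T6 j = Re (pd j (\<lambda>y. complex_of_real (lap \<phi> y) * cinner (covd A j f y) (f y)) x)" for j
  define T7 where "T7 j = Re (pd j (\<lambda>y. complex_of_real (pd j (lap \<phi>) y * (norm (f y))\<^sup>2)) x)" for j
  have T4: "T4 j k = P j k * (D j \<bullet> D k) + p k * (DD j j \<bullet> D k + D j \<bullet> DD j k)" for j k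
    unfolding T4_def by (subst pdw) (simp_all add: d\<phi> dD Re_cinner P_def p_def D_def DD_def)
  have T5: "T5 j k = P k k * (D j \<bullet> D j) + 2 * p k * (D j \<bullet> DD k j)" for j k
    unfolding T5_def by (subst pdw) (simp_all add: d\<phi> dD Re_cinner P_def p_def D_def DD_def inner_commute)
  have T6: "T6 j = pd j (lap \<phi>) x * (D j \<bullet> f x) + L * (DD j j \<bullet> f x + D j \<bullet> D j)" for j
    unfolding T6_def by (subst pdw) (simp_all add: d\<phi> df dD Re_cinner L_def D_def DD_def)
  have T7: "T7 j = pd j (pd j (lap \<phi>)) x * (f x \<bullet> f x) + 2 * pd j (lap \<phi>) x * (D j \<bullet> f x)" for j
    unfolding T7_def of_real_mult norm_eq
    by (subst pdw) (simp_all add: d\<phi> df Re_cinner D_def inner_commute)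
  have im: "D j \<bullet> ((\<i> * complex_of_real (b j k)) *s f x) = - b j k * Im (cinner (f x) (D j))" for j k
    by (subst inner_commute) (simp add: Re_cinner[symmetric] cinner_scale_left)
  \<comment> \<open>\<open>T4\<close> moves one derivative from \<open>DD j j\<close> to the other
    factors and leaves D_j . DD_jk. Exchanging the derivatives in DD_jk costs the field term
    \<open>im\<close>; what remains, D_j . DD_kj, is half the derivative of |D_j|^2 and is handled
    by \<open>T5\<close>.\<close>
  have step: "2 * p k * (DD j j \<bullet> D k) =
     2 * T4 j k - T5 j k - 2 * (P j k * (D j \<bullet> D k)) + P k k * (D j \<bullet> D j) + 2 * (p k * b j k * Im (cinner (f x) (D j)))" for j k
    unfolding T4 T5 comm[of j k] inner_add_right im by (simp add: algebra_simps)
  \<comment> \<open>Renaming the indices and using antisymmetry of the field brings the sum to the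
    index order of the virial identity and reverses its sign.\<close>
  have swap: "(\<Sum>j\<in>UNIV. \<Sum>k\<in>UNIV. p k * b j k * Im (cinner (f x) (D j)))
      = - (\<Sum>j\<in>UNIV. \<Sum>k\<in>UNIV. p j * b j k * Im (cinner (f x) (D k)))"
  proof -
    have "(\<Sum>j\<in>UNIV. \<Sum>k\<in>UNIV. p k * b j k * Im (cinner (f x) (D j)))
        = (\<Sum>j\<in>UNIV. \<Sum>k\<in>UNIV. p j * b k j * Im (cinner (f x) (D k)))"
      by (rule sum.swap)
    also have "\<dots> = (\<Sum>j\<in>UNIV. \<Sum>k\<in>UNIV. - (p j * b j k * Im (cinner (f x) (D k))))"
    proof (intro sum.cong refl)
      fix j k
      show "p j * b k j * Im (cinner (f x) (D k)) = - (p j * b j k * Im (cinner (f x) (D k)))"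
        unfolding b_def magB_swap[of A k j] by simp
    qed
    finally show ?thesis by (simp add: sum_negf)
  qed
  have lapl: "(\<Sum>k\<in>UNIV. 2 * p k * ((\<Sum>j\<in>UNIV. DD j j) \<bullet> D k)) + L * ((\<Sum>j\<in>UNIV. DD j j) \<bullet> f x) =
      2 * (\<Sum>j\<in>UNIV. \<Sum>k\<in>UNIV. T4 j k) - (\<Sum>j\<in>UNIV. \<Sum>k\<in>UNIV. T5 j k)
      + (\<Sum>j\<in>UNIV. T6 j) - (\<Sum>j\<in>UNIV. T7 j) / 2
      - 2 * (\<Sum>j\<in>UNIV. \<Sum>k\<in>UNIV. P j k * (D j \<bullet> D k))
      + lap (lap \<phi>) x * (f x \<bullet> f x) / 2
      - 2 * (\<Sum>j\<in>UNIV. \<Sum>k\<in>UNIV. p j * b j k * Im (cinner (f x) (D k)))"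
  proof -
    have "(\<Sum>k\<in>UNIV. 2 * p k * ((\<Sum>j\<in>UNIV. DD j j) \<bullet> D k)) = (\<Sum>k\<in>UNIV. \<Sum>j\<in>UNIV. 2 * p k * (DD j j \<bullet> D k))"
      by (simp add: inner_sum_left sum_distrib_left)
    also have "\<dots> = (\<Sum>j\<in>UNIV. \<Sum>k\<in>UNIV. 2 * p k * (DD j j \<bullet> D k))"
      by (rule sum.swap)
    also have "\<dots> = 2 * (\<Sum>j\<in>UNIV. \<Sum>k\<in>UNIV. T4 j k) - (\<Sum>j\<in>UNIV. \<Sum>k\<in>UNIV. T5 j k)
      - 2 * (\<Sum>j\<in>UNIV. \<Sum>k\<in>UNIV. P j k * (D j \<bullet> D k)) + L * (\<Sum>j\<in>UNIV. D j \<bullet> D j)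
      + 2 * (\<Sum>j\<in>UNIV. \<Sum>k\<in>UNIV. p k * b j k * Im (cinner (f x) (D j)))"
      unfolding step sum.distrib sum_subtractf
      by (simp add: sum_distrib_left[symmetric] sum_distrib_right[symmetric] L mult.commute)
    finally have 1: "(\<Sum>k\<in>UNIV. 2 * p k * ((\<Sum>j\<in>UNIV. DD j j) \<bullet> D k)) = \<dots>" .
    \<comment> \<open>\<open>T6\<close> moves a derivative off \<open>DD j j\<close>; the resulting
      product of grad \<open>L\<close> with D_j . f is half of grad \<open>L\<close> times the
      gradient of |f|^2, which \<open>T7\<close> moves onto \<open>L\<close>, giving the
      bilaplacian. The leftover -L |D_j|^2 cancels against the trace term +L |D_j|^2 that
      \<open>step\<close> produces.\<close>
    have "L * ((\<Sum>j\<in>UNIV. DD j j) \<bullet> f x) = (\<Sum>j\<in>UNIV. L * (DD j j \<bullet> f x))"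
      by (simp add: inner_sum_left sum_distrib_left)
    also have "\<dots> = (\<Sum>j\<in>UNIV. T6 j - T7 j / 2 + pd j (pd j (lap \<phi>)) x * (f x \<bullet> f x) / 2 - L * (D j \<bullet> D j))"
      by (intro sum.cong refl) (simp add: T6 T7 field_simps)
    also have "\<dots> = (\<Sum>j\<in>UNIV. T6 j) - (\<Sum>j\<in>UNIV. T7 j) / 2 + lap (lap \<phi>) x * (f x \<bullet> f x) / 2
        - L * (\<Sum>j\<in>UNIV. D j \<bullet> D j)"
      by (simp add: sum.distrib sum_subtractf sum_distrib_left lap_def[of "lap \<phi>"] sum_distrib_right sum_divide_distrib)
    finally show ?thesis unfolding 1 swap by simp
  qed

  \<comment> \<open>The doubled equation is halved only here, after pairing with \<open>y\<close>
    has made it an equation between real numbers.\<close>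
  have w: "w \<bullet> y = (\<Sum>j\<in>UNIV. DD j j) \<bullet> y - m\<^sup>2 * (f x \<bullet> y) + (\<Sum>j\<in>UNIV. \<Sum>k\<in>UNIV. b j k * Re (\<i> * cinner (M j k (f x)) y)) / 2" for y
  proof -
    have csum: "cinner (\<Sum>j\<in>UNIV. g j) y = (\<Sum>j\<in>UNIV. cinner (g j) y)" for g :: "'n \<Rightarrow> _"
      by (rule bounded_bilinear.sum_left[OF bounded_bilinear_cinner])
    have "2 * (w \<bullet> y) = Re (cinner (2 *s w) y)"
      by (simp add: cinner_scale_left Re_cinner)
    also have "\<dots> = 2 * ((\<Sum>j\<in>UNIV. DD j j) \<bullet> y) - 2 * m\<^sup>2 * (f x \<bullet> y)
        + (\<Sum>j\<in>UNIV. \<Sum>k\<in>UNIV. b j k * Re (\<i> * cinner (M j k (f x)) y))"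
      unfolding wave
      by (simp add: cinner_add_left cinner_diff_left cinner_scale_left csum Re_cinner DD_def b_def M_def inner_sum_left)
    finally show ?thesis by simp
  qed
  have "(\<Sum>k\<in>UNIV. 2 * p k * (w \<bullet> D k + v x \<bullet> E k)) + L * (w \<bullet> f x + v x \<bullet> v x) =
     ((\<Sum>k\<in>UNIV. 2 * p k * (v x \<bullet> E k)) + L * (v x \<bullet> v x))
     - ((\<Sum>k\<in>UNIV. 2 * p k * (m\<^sup>2 * (f x \<bullet> D k))) + L * (m\<^sup>2 * (f x \<bullet> f x)))
     + ((\<Sum>l\<in>UNIV. 2 * p l * (\<Sum>j\<in>UNIV. \<Sum>k\<in>UNIV. b j k * r j k l)) +
        L * (\<Sum>j\<in>UNIV. \<Sum>k\<in>UNIV. b j k * q j k)) / 2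
     + ((\<Sum>k\<in>UNIV. 2 * p k * ((\<Sum>j\<in>UNIV. DD j j) \<bullet> D k)) + L * ((\<Sum>j\<in>UNIV. DD j j) \<bullet> f x))"
  proof -
    have 1: "2 * p k * (w \<bullet> D k + v x \<bullet> E k) = 2 * p k * (v x \<bullet> E k) - 2 * p k * (m\<^sup>2 * (f x \<bullet> D k)) +
       2 * p k * (\<Sum>j\<in>UNIV. \<Sum>i\<in>UNIV. b j i * r j i k) / 2 + 2 * p k * ((\<Sum>j\<in>UNIV. DD j j) \<bullet> D k)" for k
      unfolding w r_def[symmetric] by (simp add: algebra_simps)
    have 2: "L * (w \<bullet> f x + v x \<bullet> v x) = L * (v x \<bullet> v x) - L * (m\<^sup>2 * (f x \<bullet> f x)) +
       L * (\<Sum>j\<in>UNIV. \<Sum>k\<in>UNIV. b j k * q j k) / 2 + L * ((\<Sum>j\<in>UNIV. DD j j) \<bullet> f x)"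
      unfolding w q_def[symmetric] by (simp add: algebra_simps)
    show ?thesis
      unfolding 1 2 sum.distrib sum_subtractf sum_divide_distrib[symmetric]
      by (simp add: add_divide_distrib)
  qed
  also note kin also note mass also note mag also note lapl
  finally show ?thesis
    unfolding T1_def T2_def T3_def T4_def T5_def T6_def T7_def D_def E_def p_def P_def L_def b_def q_def M_def
      Re_cinner
    by (simp add: power2_norm_eq_inner mult.commute add_divide_distrib diff_divide_distrib)
qed

section \<open>Passing from the complex integrands of the identity to real ones\<close>

text \<open>The pairs above and below the diagonal contribute equally. This links the sum over j < k
  in the identity with the sum over all pairs in the squared equation, and is the source of the
  factor 1/2.\<close>

lemma sum_less_pairs:
  fixes g :: "'n::{finite,linorder} \<Rightarrow> 'n \<Rightarrow> real"
  assumes sym: "\<And>j k. g j k = g k j" and diag: "\<And>j. g j j = 0"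
  shows "(\<Sum>(j, k)\<in>{(j, k). j < k}. g j k) = (\<Sum>j\<in>UNIV. \<Sum>k\<in>UNIV. g j k) / 2"
proof -
  let ?g = "\<lambda>(j, k). g j k"
  let ?L = "{(j, k). j < (k::'n)}" and ?G = "{(j, k). k < (j::'n)}" and ?D = "{(j, k). j = (k::'n)}"
  have "(\<Sum>j\<in>UNIV. \<Sum>k\<in>UNIV. g j k) = sum ?g (UNIV \<times> UNIV)"
    by (rule sum.cartesian_product)
  also have "UNIV \<times> UNIV = ?L \<union> (?G \<union> ?D)" by auto
  also have "sum ?g \<dots> = sum ?g ?L + (sum ?g ?G + sum ?g ?D)"
    by (subst sum.union_disjoint; (subst sum.union_disjoint)?) auto
  also have "sum ?g ?D = 0"
    by (rule sum.neutral) (auto simp: diag)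
  also have "sum ?g ?G = sum ?g ?L"
    by (rule sum.reindex_bij_witness[of _ "\<lambda>(j, k). (k, j)" "\<lambda>(j, k). (k, j)"]) (auto simp: sym)
  finally show ?thesis by simp
qed

text \<open>Exchanging the indices conjugates the hermitian product, so against a symmetric weight
  the imaginary parts cancel in pairs. The weight in question is the Hessian of \<phi>.\<close>

lemma symmetric_form_real:
  fixes P :: "'n::finite \<Rightarrow> 'n \<Rightarrow> real"
  assumes sym: "\<And>j k. P j k = P k j"
  shows "(\<Sum>j\<in>UNIV. \<Sum>k\<in>UNIV. complex_of_real (P j k) * cinner (D j) (D k)) =
    complex_of_real (\<Sum>j\<in>UNIV. \<Sum>k\<in>UNIV. P j k * Re (cinner (D j) (D k)))"
proof -
  have "Im (cinner (D j) (D k)) = - Im (cinner (D k) (D j))" for j k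
    by (metis cnj.simps(2) cnj_cinner)
  then have "P j k * Im (cinner (D j) (D k)) = - (P k j * Im (cinner (D k) (D j)))" for j k
    by (metis sym mult_minus_right)
  then have "(\<Sum>j\<in>UNIV. \<Sum>k\<in>UNIV. P j k * Im (cinner (D j) (D k))) =
      - (\<Sum>j\<in>UNIV. \<Sum>k\<in>UNIV. P k j * Im (cinner (D k) (D j)))"
    unfolding sum_negf[symmetric] by (intro sum.cong refl)
  also have "(\<Sum>j\<in>UNIV. \<Sum>k\<in>UNIV. P k j * Im (cinner (D k) (D j))) =
     (\<Sum>j\<in>UNIV. \<Sum>k\<in>UNIV. P j k * Im (cinner (D j) (D k)))"
    by (rule sum.swap)
  finally have "(\<Sum>j\<in>UNIV. \<Sum>k\<in>UNIV. P j k * Im (cinner (D j) (D k))) = 0" by simp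
  then show ?thesis
    by (simp add: complex_eq_iff)
qed

text \<open>For distinct indices i \<alpha>_j \<alpha>_k is hermitian, so its quadratic form is
  real; both B^{jk} and \<alpha>_j \<alpha>_k change sign when j and k are exchanged, so their
  product is symmetric and the half-sum over all pairs applies.\<close>

lemma magnetic_term_real:
  fixes \<alpha> :: "'n::{finite,linorder} \<Rightarrow> complex^'m::finite^'m"
  assumes dirac: "dirac_matrices \<beta> \<alpha>" and A: "Ck 2 A"
  shows "\<i> * (\<Sum>(j, k)\<in>{(j, k). j < k}. complex_of_real (\<Sum>l\<in>UNIV. p l * pd l (magB A j k) x) *
      cinner ((\<alpha> j ** \<alpha> k) *v a) a) =
    complex_of_real ((\<Sum>j\<in>UNIV. \<Sum>k\<in>UNIV. \<Sum>l\<in>UNIV. p l * pd l (magB A j k) x *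
      Re (\<i> * cinner ((\<alpha> j ** \<alpha> k) *v a) a)) / 2)"
proof -
  define q where "q j k = Re (\<i> * cinner ((\<alpha> j ** \<alpha> k) *v a) a)" for j k
  define h where "h j k = (\<Sum>l\<in>UNIV. p l * pd l (magB A j k) x * q j k)" for j k
  have q_imag: "\<i> * cinner ((\<alpha> j ** \<alpha> k) *v a) a = complex_of_real (q j k)" if "j \<noteq> k" for j k
  proof -
    have "Re (cinner ((\<alpha> j ** \<alpha> k) *v a) a) = 0"
      using arg_cong[OF cinner_dirac_product[OF dirac that, of a a], of Re] by simp
    then show ?thesis by (simp add: q_def complex_eq_iff)
  qed
  have magB_sw: "magB A j k = (\<lambda>y. - magB A k j y)" for j k
    by (intro ext magB_swap)
  have pd_sw: "pd l (magB A j k) x = - pd l (magB A k j) x" for l j k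
    unfolding magB_sw[of j k] by (rule pd_uminus[OF magB_differentiable[OF A]])
  have q_sw: "q k j = - q j k" if "j \<noteq> k" for j k
    unfolding q_def dirac_product_swap[OF dirac that] by (simp add: cinner_minus_left)
  have h_sym: "h j k = h k j" for j k
  proof (cases "j = k")
    case False
    show ?thesis
      unfolding h_def q_sw[OF False] pd_sw[of _ k j] by simp
  qed simp
  \<comment> \<open>At equal indices \<open>pd_sw\<close> says that a number equals its own
    negative.\<close>
  have h_diag: "h j j = 0" for j
    using pd_sw[of _ j j] by (simp add: h_def)
  have "\<i> * (\<Sum>(j, k)\<in>{(j, k). j < k}. complex_of_real (\<Sum>l\<in>UNIV. p l * pd l (magB A j k) x) *
      cinner ((\<alpha> j ** \<alpha> k) *v a) a) = (\<Sum>(j, k)\<in>{(j, k). j < k}. complex_of_real (h j k))"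
    unfolding sum_distrib_left
  proof (intro sum.cong refl, clarsimp)
    fix j k :: 'n assume "j < k"
    then show "\<i> * ((\<Sum>l\<in>UNIV. complex_of_real (p l) * complex_of_real (pd l (magB A j k) x)) * cinner ((\<alpha> j ** \<alpha> k) *v a) a) =
        complex_of_real (h j k)"
      using q_imag[of j k] unfolding h_def
      by (simp add: sum_distrib_right[symmetric] mult.left_commute[of \<i>])
  qed
  also have "\<dots> = complex_of_real (\<Sum>(j, k)\<in>{(j, k). j < k}. h j k)"
    by (simp add: case_prod_unfold)
  finally show ?thesis
    unfolding sum_less_pairs[OF h_sym h_diag] unfolding h_def q_def .
qed

text \<open>Stating integrability and the value 0 as one judgement lets the many divergence terms be
  assembled by introduction rules. The constant \<open>c\<close> is there for the magnetic fields,
  which carry the factor i.\<close>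

lemma has_bochner_integral_Re_pd:
  assumes "integrable_C1 F" "\<And>x. F differentiable (at x)"
  shows "has_bochner_integral lborel (\<lambda>x. Re (c * pd i F x)) 0"
proof -
  have i: "integrable lborel F" "integrable lborel (pd i F)"
    using assms(1) by (auto simp: integrable_C1_def)
  then have "(\<integral>x. pd i F x \<partial>lborel) = 0"
    unfolding pd_def by (intro integral_dird_eq_0 assms(2))
  then have "has_bochner_integral lborel (\<lambda>x. c * pd i F x) 0"
    using i by (simp add: has_bochner_integral_iff)
  then show ?thesis
    using has_bochner_integral_Re by fastforce
qed

section \<open>Time derivatives along the flow\<close>

text \<open>The potential does not depend on time, so apart from symmetry of the mixed derivatives
  of \<open>u\<close> only linearity is involved.\<close>

lemma covd_has_vector_derivative:
  fixes u :: "real \<Rightarrow> real^'n::finite \<Rightarrow> complex^'m::finite"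
  assumes u: "Ck 2 (\<lambda>(t, x). u t x)"
  shows "((\<lambda>s. covd A k (u s) x) has_vector_derivative covd A k (dt u t) x) (at t)"
proof -
  have C: "Ck (Suc (Suc 0)) (\<lambda>(t, x). u t x)" using u by (simp add: numeral_2_eq_2)
  have "((\<lambda>s. pd k (u s) x) has_vector_derivative pd k (dt u t) x) (at t)"
    using has_vector_derivative_dt[OF Ck_pd_joint[OF C]] dt_pd_commute[OF u] by metis
  then show ?thesis
    unfolding covd_def
    by (intro has_vector_derivative_diff bounded_linear.has_vector_derivative[OF bounded_linear_vector_scale]
        has_vector_derivative_dt[OF C])
qed

text \<open>The operator is linear with coefficients independent of time, so the flow equation may
  be differentiated in time. Replacing the remaining \<open>dt u\<close> by the flow equation again
  makes \<open>dirac_op_squared\<close> applicable.\<close>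

lemma dirac_flow_second_derivative:
  fixes u :: "real \<Rightarrow> real^'n::finite \<Rightarrow> complex^'m::finite"
  assumes u: "Ck 2 (\<lambda>(t, x). u t x)"
    and eq: "\<And>t x. dt u t x = \<i> *s dirac_op A m \<beta> \<alpha> (u t) x"
  shows "dt (dt u) t x = \<i> *s dirac_op A m \<beta> \<alpha> (dt u t) x"
proof -
  have C: "Ck (Suc (Suc 0)) (\<lambda>(t, x). u t x)" using u by (simp add: numeral_2_eq_2)
  have "((\<lambda>s. \<i> *s dirac_op A m \<beta> \<alpha> (u s) x) has_vector_derivative \<i> *s dirac_op A m \<beta> \<alpha> (dt u t) x) (at t)"
    unfolding dirac_op_imaginary
    by (intro has_vector_derivative_add has_vector_derivative_sum
        bounded_linear.has_vector_derivative[OF bounded_linear_vector_scale]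
        bounded_linear.has_vector_derivative[OF bounded_linear_matrix_vector]
        covd_has_vector_derivative[OF u] has_vector_derivative_dt[OF C])
  then show ?thesis
    unfolding eq[symmetric] dt_def[of "dt u"] by (rule vector_derivative_at)
qed

lemma virial_density_has_derivative:
  fixes u :: "real \<Rightarrow> real^'n::finite \<Rightarrow> complex^'m::finite"
  assumes u: "Ck 2 (\<lambda>(t, x). u t x)"
  shows "((\<lambda>s. virial_density A \<phi> u s x) has_vector_derivative
    (\<Sum>k\<in>UNIV. 2 * pd k \<phi> x * (dt (dt u) t x \<bullet> covd A k (u t) x + dt u t x \<bullet> covd A k (dt u t) x)) +
    lap \<phi> x * (dt (dt u) t x \<bullet> u t x + dt u t x \<bullet> dt u t x)) (at t)"
proof -
  have C: "Ck (Suc (Suc 0)) (\<lambda>(t, x). u t x)" using u by (simp add: numeral_2_eq_2)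
  have density: "virial_density A \<phi> u s x =
      (\<Sum>k\<in>UNIV. 2 * pd k \<phi> x * (dt u s x \<bullet> covd A k (u s) x)) + lap \<phi> x * (dt u s x \<bullet> u s x)" for s
    unfolding virial_density_def by (simp add: Re_cinner sum_distrib_left mult.assoc)
  have inner: "((\<lambda>s. f s \<bullet> g s) has_vector_derivative (f' \<bullet> g t + f t \<bullet> g')) (at t)"
    if "(f has_vector_derivative f') (at t)" "(g has_vector_derivative g') (at t)" for f g f' g' and t
    using bounded_bilinear.has_vector_derivative[OF bounded_bilinear_inner that] by (simp add: add.commute)
  show ?thesis
    unfolding density
    by (intro has_vector_derivative_add has_vector_derivative_sum has_vector_derivative_mult_right inner
        covd_has_vector_derivative[OF u] has_vector_derivative_dt[OF C] has_vector_derivative_dt[OF Ck_dt[OF C]])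
qed

theorem theorem1p2:
  fixes A :: "real^'n::{finite,linorder} \<Rightarrow> real^'n::{finite,linorder}"
    and m :: real
    and \<beta> :: "complex^'m::finite^'m"
    and \<alpha> :: "'n \<Rightarrow> complex^'m^'m"
    and \<phi> :: "real^'n::{finite,linorder} \<Rightarrow> real"
    and u :: "real \<Rightarrow> real^'n::{finite,linorder} \<Rightarrow> complex^'m"
    and t :: real
  assumes "CARD('n) \<ge> 2" and "m \<ge> 0"
    and "dirac_matrices \<beta> \<alpha>"
    and "selfadjointness_assumption A m \<beta> \<alpha>"
    and "\<And>t x. \<i> *s dt u t x + dirac_op A m \<beta> \<alpha> (u t) x = 0"
    and "regular_enough A \<phi> u"
    and "integrals_converge A \<phi> \<alpha> u"
    and "time_derivative_dominated A \<phi> u"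
    and "no_boundary_terms A m \<phi> \<alpha> u"
  shows "(\<lambda>s. \<integral>x. virial_density A \<phi> u s x \<partial>lborel) differentiable (at t) \<and>
      2 * (\<integral>x. (\<Sum>j\<in>UNIV. \<Sum>k\<in>UNIV. complex_of_real (pd j (pd k \<phi>) x) *
              cinner (covd A j (u t) x) (covd A k (u t) x)) \<partial>lborel)
        - complex_of_real (1/2 * (\<integral>x. (norm (u t x))\<^sup>2 * lap (lap \<phi>) x \<partial>lborel))
        + complex_of_real (2 * (\<integral>x. (\<Sum>j\<in>UNIV. \<Sum>k\<in>UNIV. pd j \<phi> x * magB A j k x *
              Im (cinner (u t x) (covd A k (u t) x))) \<partial>lborel))
        + \<i> * (\<integral>x. (\<Sum>(j, k)\<in>{(j, k). j < k}.
              complex_of_real (\<Sum>l\<in>UNIV. pd l \<phi> x * pd l (magB A j k) x) *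
              cinner ((\<alpha> j ** \<alpha> k) *v u t x) (u t x)) \<partial>lborel)
      = - complex_of_real (deriv (\<lambda>s. \<integral>x. Re (2 * (\<Sum>k\<in>UNIV. complex_of_real (pd k \<phi> x) *
              cinner (dt u s x) (covd A k (u s) x))
            + complex_of_real (lap \<phi> x) * cinner (dt u s x) (u s x)) \<partial>lborel) t)"
proof -
  note no_boundary = assms(9)[unfolded no_boundary_terms_def, rule_format]
  note converge = assms(7)[unfolded integrals_converge_def, rule_format]
  have A: "Ck 2 A" and \<phi>: "Ck 4 \<phi>" and u: "Ck 2 (\<lambda>(t, x). u t x)"
    using assms(6) unfolding regular_enough_def by auto
  have dA: "A differentiable (at x)" for x using A by (simp add: numeral_2_eq_2)
  have f: "Ck 2 (u t)" by (rule Ck_slice[OF u])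
  have df: "u t differentiable (at x)" for x using f by (simp add: numeral_2_eq_2)
  have dv: "dt u t differentiable (at x)" for x
  proof -
    have "Ck (Suc 0) (dt u t)"
      by (rule Ck_slice[OF Ck_dt]) (use u in \<open>simp add: numeral_2_eq_2\<close>)
    then show ?thesis by simp
  qed
  note dD = covd_differentiable[OF dA f] and d\<phi> = weight_differentiable[OF \<phi>]
  have dM: "(\<lambda>x. (\<alpha> j ** \<alpha> k) *v u t x) differentiable (at x)" for j k x
    by (rule bounded_linear_differentiable[OF bounded_linear_matrix_vector df])
  have eq: "dt u s x = \<i> *s dirac_op A m \<beta> \<alpha> (u s) x" for s x
  proof -
    have "\<i> *s (\<i> *s dt u s x + dirac_op A m \<beta> \<alpha> (u s) x) = 0"
      using assms(5) by simp
    then show ?thesis by (simp add: vec_eq_iff distrib_left)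
  qed
  then have dt_eq: "dt u t = (\<lambda>x. \<i> *s dirac_op A m \<beta> \<alpha> (u t) x)" by auto
  have wave: "2 *s dt (dt u) t x = 2 *s (\<Sum>j\<in>UNIV. covd A j (covd A j (u t)) x)
      - complex_of_real (2 * m\<^sup>2) *s u t x +
      (\<Sum>j\<in>UNIV. \<Sum>k\<in>UNIV. (\<i> * complex_of_real (magB A j k x)) *s ((\<alpha> j ** \<alpha> k) *v u t x))" for x
    unfolding dirac_flow_second_derivative[OF u eq] dt_eq
    by (rule dirac_op_squared[OF dA f assms(3)])

  let ?\<rho> = "virial_density A \<phi> u"
  have \<rho>_deriv: "((\<lambda>s. ?\<rho> s x) has_real_derivative dt ?\<rho> s x) (at s)" for s x
    unfolding has_real_derivative_iff_has_vector_derivative dt_def[of ?\<rho>]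
      vector_derivative_at[OF virial_density_has_derivative[OF u]]
    by (rule virial_density_has_derivative[OF u])
  obtain \<epsilon> g where "\<epsilon> > 0" "integrable lborel g"
    "\<And>s x. \<bar>s - t\<bar> < \<epsilon> \<Longrightarrow> \<bar>dt ?\<rho> s x\<bar> \<le> g x"
    using assms(8) unfolding time_derivative_dominated_def by metis
  then have deriv: "((\<lambda>s. \<integral>x. ?\<rho> s x \<partial>lborel) has_real_derivative (\<integral>x. dt ?\<rho> t x \<partial>lborel)) (at t)"
    using converge \<rho>_deriv by (intro has_real_derivative_integral_dominated) auto

  let ?Q1 = "\<lambda>x. \<Sum>j\<in>UNIV. \<Sum>k\<in>UNIV. complex_of_real (pd j (pd k \<phi>) x) *
      cinner (covd A j (u t) x) (covd A k (u t) x)"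
  let ?R1 = "\<lambda>x. \<Sum>j\<in>UNIV. \<Sum>k\<in>UNIV. pd j (pd k \<phi>) x * Re (cinner (covd A j (u t) x) (covd A k (u t) x))"
  let ?R2 = "\<lambda>x. (norm (u t x))\<^sup>2 * lap (lap \<phi>) x"
  let ?R3 = "\<lambda>x. \<Sum>j\<in>UNIV. \<Sum>k\<in>UNIV. pd j \<phi> x * magB A j k x * Im (cinner (u t x) (covd A k (u t) x))"
  let ?Q4 = "\<lambda>x. \<Sum>(j, k)\<in>{(j, k). j < k}. complex_of_real (\<Sum>l\<in>UNIV. pd l \<phi> x * pd l (magB A j k) x) *
      cinner ((\<alpha> j ** \<alpha> k) *v u t x) (u t x)"
  let ?R4 = "\<lambda>x. (\<Sum>j\<in>UNIV. \<Sum>k\<in>UNIV. \<Sum>l\<in>UNIV. pd l \<phi> x * pd l (magB A j k) x *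
      Re (\<i> * cinner ((\<alpha> j ** \<alpha> k) *v u t x) (u t x))) / 2"
  have "Ck 2 \<phi>"
    using Ck_SucD[of 2 \<phi>, OF Ck_SucD] \<phi> by (simp add: eval_nat_numeral)
  then have Q1: "?Q1 x = complex_of_real (?R1 x)" for x
    by (intro symmetric_form_real pd_commute)
  have Q4: "\<i> * ?Q4 x = complex_of_real (?R4 x)" for x
    by (rule magnetic_term_real[OF assms(3) A])
  \<comment> \<open>The complex integrand is pointwise the embedding of a real one, so integrability
    and the value of the integral carry over to the real integrand.\<close>
  have I1: "integrable lborel ?R1" and Q1_int: "(\<integral>x. ?Q1 x \<partial>lborel) = complex_of_real (\<integral>x. ?R1 x \<partial>lborel)"
    using converge[of t] unfolding Q1 by (auto simp only: complex_of_real_integrable_eq integral_complex_of_real)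
  have I2: "integrable lborel ?R2" and I3: "integrable lborel ?R3"
    using converge[of t] by auto
  have "integrable lborel (\<lambda>x. \<i> * ?Q4 x)"
    using converge[of t] by (intro integrable_mult_right) auto
  then have I4: "integrable lborel ?R4"
    unfolding Q4 complex_of_real_integrable_eq .
  have Q4_int: "\<i> * (\<integral>x. ?Q4 x \<partial>lborel) = complex_of_real (\<integral>x. ?R4 x \<partial>lborel)"
    unfolding integral_complex_of_real[symmetric] Q4[symmetric] by (rule integral_mult_right_zero[symmetric])

  note zero = has_bochner_integral_Re_pd[where c = 1, unfolded mult_1]
  have dN: "(\<lambda>x. complex_of_real (a x * (norm (h x))\<^sup>2)) differentiable (at x)"
    if "\<And>x. a differentiable (at x)" "\<And>x. h differentiable (at x)"
    for a :: "_ \<Rightarrow> real" and h :: "_ \<Rightarrow> complex^'m" and x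
    unfolding of_real_mult cinner_self[symmetric] by (intro weighted_cinner_differentiable that)
  have dm: "(\<lambda>x. m\<^sup>2 * pd k \<phi> x) differentiable (at x)" for k x
    using d\<phi> by (intro differentiable_mult) auto
  have Z1: "has_bochner_integral lborel (\<lambda>x. Re (pd k (\<lambda>y. complex_of_real (pd k \<phi> y * (norm (dt u t y))\<^sup>2)) x)) 0" for k
    using no_boundary by (intro zero dN d\<phi> dv) blast
  have Z2: "has_bochner_integral lborel (\<lambda>x. Re (pd k (\<lambda>y. complex_of_real (m\<^sup>2 * pd k \<phi> y * (norm (u t y))\<^sup>2)) x)) 0" for k
    using no_boundary by (intro zero dN dm df) blast
  have Z3: "has_bochner_integral lborel (\<lambda>x. Re (\<i> * pd l (\<lambda>y. complex_of_real (pd l \<phi> y * magB A j k y) *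
        cinner ((\<alpha> j ** \<alpha> k) *v u t y) (u t y)) x)) 0" for j k l
    using no_boundary
    by (intro has_bochner_integral_Re_pd weighted_cinner_differentiable differentiable_mult d\<phi>
        magB_differentiable[OF A] dM df) blast
  \<comment> \<open>The direction \<open>i\<close> of differentiation and the index \<open>l\<close>
    of the weight are left independent, so that this covers both divergence fields quadratic in the
    covariant derivatives.\<close>
  have Z4: "has_bochner_integral lborel (\<lambda>x. Re (pd i (\<lambda>y. complex_of_real (pd l \<phi> y) *
        cinner (covd A j (u t) y) (covd A k (u t) y)) x)) 0" for i j k l
    using no_boundary by (intro zero weighted_cinner_differentiable d\<phi> dD) blast
  have Z6: "has_bochner_integral lborel (\<lambda>x. Re (pd j (\<lambda>y. complex_of_real (lap \<phi> y) *
        cinner (covd A j (u t) y) (u t y)) x)) 0" for j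
    using no_boundary by (intro zero weighted_cinner_differentiable d\<phi> dD df) blast
  have Z7: "has_bochner_integral lborel (\<lambda>x. Re (pd j (\<lambda>y. complex_of_real (pd j (lap \<phi>) y * (norm (u t y))\<^sup>2)) x)) 0" for j
    using no_boundary by (intro zero dN d\<phi> df) blast

  have dt_\<rho>: "dt ?\<rho> t x = (\<Sum>k\<in>UNIV. 2 * pd k \<phi> x * (dt (dt u) t x \<bullet> covd A k (u t) x + dt u t x \<bullet> covd A k (dt u t) x)) +
    lap \<phi> x * (dt (dt u) t x \<bullet> u t x + dt u t x \<bullet> dt u t x)" for x
    unfolding dt_def[of ?\<rho>] by (rule vector_derivative_at[OF virial_density_has_derivative[OF u]])
  \<comment> \<open>The sums of zeros copy the shape of \<open>virial_divergence_form\<close> term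
    by term, so that the introduction rules match; simplification then collapses them.\<close>
  have "has_bochner_integral lborel (dt ?\<rho> t)
      ((\<Sum>k\<in>(UNIV::'n set). 0) - (\<Sum>k\<in>(UNIV::'n set). 0)
       + (\<Sum>j\<in>(UNIV::'n set). \<Sum>k\<in>(UNIV::'n set). \<Sum>l\<in>(UNIV::'n set). 0) / 2
       + 2 * (\<Sum>j\<in>(UNIV::'n set). \<Sum>k\<in>(UNIV::'n set). 0) - (\<Sum>j\<in>(UNIV::'n set). \<Sum>k\<in>(UNIV::'n set). 0)
       + (\<Sum>j\<in>(UNIV::'n set). 0) - (\<Sum>j\<in>(UNIV::'n set). 0) / 2
       - 2 * (\<integral>x. ?R1 x \<partial>lborel) + (\<integral>x. ?R2 x \<partial>lborel) / 2 - 2 * (\<integral>x. ?R3 x \<partial>lborel) - (\<integral>x. ?R4 x \<partial>lborel))"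
    unfolding dt_\<rho>[abs_def] virial_divergence_form[OF A \<phi> f dv assms(3) wave]
    by (intro has_bochner_integral_add has_bochner_integral_diff has_bochner_integral_sum
        has_bochner_integral_mult_right has_bochner_integral_divide_zero Z1 Z2 Z3 Z4 Z6 Z7
        has_bochner_integral_integrable I1 I2 I3 I4)
  then have "(\<integral>x. dt ?\<rho> t x \<partial>lborel) = - 2 * (\<integral>x. ?R1 x \<partial>lborel) + (\<integral>x. ?R2 x \<partial>lborel) / 2
      - 2 * (\<integral>x. ?R3 x \<partial>lborel) - (\<integral>x. ?R4 x \<partial>lborel)"
    by (simp add: has_bochner_integral_integral_eq)
  moreover have "deriv (\<lambda>s. \<integral>x. ?\<rho> s x \<partial>lborel) t = (\<integral>x. dt ?\<rho> t x \<partial>lborel)"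
    by (rule DERIV_imp_deriv[OF deriv])
  ultimately have "2 * (\<integral>x. ?Q1 x \<partial>lborel) - complex_of_real (1/2 * (\<integral>x. ?R2 x \<partial>lborel))
      + complex_of_real (2 * (\<integral>x. ?R3 x \<partial>lborel)) + \<i> * (\<integral>x. ?Q4 x \<partial>lborel)
    = - complex_of_real (deriv (\<lambda>s. \<integral>x. ?\<rho> s x \<partial>lborel) t)"
    unfolding Q1_int Q4_int by simp
  moreover have "(\<lambda>s. \<integral>x. ?\<rho> s x \<partial>lborel) differentiable (at t)"
    using deriv by (auto simp: real_differentiable_def)
  ultimately show ?thesis
    unfolding virial_density_def by (intro conjI)
qed

end
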